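(* Let $T$ be large, $y\le\log T$ real, and $f$ a completely multiplicative function with $|f(n)|=1$ for all $n$. Let $L_f(s,y)=\prod_{p\le y}(1-f(p)p^{-s})^{-1}$ and $R_y=\prod_{p\le y}(1-1/p)^{-1}$. If $k\le y/(\log y)^2$ is a positive integer and $\alpha=y/k$, then $$\frac1T\int_T^{2T}\left|L_f(1+it,y)+R_y\right|^{2k}dt=(2R_y)^{2k}\exp\left(\frac{k}{\log k}\left(-\log\alpha+O\left(1+\frac{(\log\alpha)^2}{\log k}\right)\right)\right).$$
   Context: $p$ runs over primes.
   Formalization: The case k = 1 is excluded (k ≥ 2 is assumed), because log k = 0 there and the expressions k/log k and (log α)²/log k on the right-hand side are undefined. *)

theory Defs
  imports "HOL-Analysis.Analysis" "HOL-Computational_Algebra.Primes"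
begin

text \<open>Arithmetic functions live on the positive integers; the value at \<open>0\<close> is unconstrained.\<close>

definition completely_multiplicative :: "(nat \<Rightarrow> complex) \<Rightarrow> bool" where
  "completely_multiplicative f \<longleftrightarrow>
     f 1 = 1 \<and> (\<forall>m n. m > 0 \<longrightarrow> n > 0 \<longrightarrow> f (m * n) = f m * f n)"

definition euler_L :: "(nat \<Rightarrow> complex) \<Rightarrow> complex \<Rightarrow> real \<Rightarrow> complex" where
  "euler_L f s y =
     (\<Prod>p | prime p \<and> real p \<le> y. inverse (1 - f p * of_nat p powr (- s)))"

definition euler_R :: "real \<Rightarrow> real" where
  "euler_R y = (\<Prod>p | prime p \<and> real p \<le> y. inverse (1 - 1 / real p))"

end

theory Submission
  imports Defs "HOL-Number_Theory.Prime_Powers"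
begin

text \<open>
  Write \<open>(L + R)\<^sup>k\<close> as a Dirichlet series with coefficients \<open>c\<^sub>n f(n)\<close>, \<open>c\<^sub>n \<ge> 0\<close>. Up to a
  small off-diagonal term the \<open>2k\<close>-th moment is \<open>\<Sum> c\<^sub>n\<^sup>2\<close>, whatever \<open>f\<close> is.
  Both bounds isolate the primes \<open>p \<le> k\<close>, which behave as if \<open>f(p) = p\<^bsup>it\<^esup>\<close>, from the primes in
  \<open>(k, y]\<close>, which average out; put \<open>R\<^sub>k = \<Prod>\<^bsub>p \<le> k\<^esub> (1 - 1/p)\<^sup>-\<^sup>1\<close>.

  Lower bound: by Cauchy-Schwarz \<open>\<Sum> c\<^sub>n\<^sup>2 \<ge> (\<Sum> c\<^sub>n w\<^sub>n)\<^sup>2 / \<Sum> w\<^sub>n\<^sup>2\<close> for the completely multiplicative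
  \<open>w\<close> with \<open>w(p) = 1 - p/(2k)\<close> for \<open>p \<le> k\<close> and \<open>w(p) = 0\<close> otherwise; the numerator is essentially
  \<open>(R + R\<^sub>k)\<^bsup>2k\<^esup>\<close> and the denominator is \<open>exp (O(k / ln k))\<close>.

  Upper bound: \<open>|L| \<le> R\<^sub>k |M|\<close> with \<open>M\<close> the product over \<open>k < p \<le> y\<close>, convexity of \<open>x\<^bsup>2k\<^esup>\<close> reduces the
  claim to the \<open>2k\<close>-th moment of \<open>M\<close>, and this is \<open>exp (O(k / ln k))\<close> because \<open>\<Sum>\<^bsub>p > k\<^esub> 1/p\<^sup>2\<close> is
  \<open>O(1 / (k ln k))\<close>.

  Finally \<open>R\<^sub>k / R\<close> is \<open>exp (-s)\<close> up to a bounded power of \<open>exp (1 / ln k)\<close>, where \<open>s\<close>, the sum of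
  \<open>1/p\<close> over \<open>k < p \<le> y\<close>, lies between \<open>(ln \<alpha> - O(1)) / ln y\<close> and \<open>(ln \<alpha> + O(1)) / ln k\<close>
  by Mertens' first theorem.
\<close>

section \<open>Chebyshev and Mertens estimates\<close>

text \<open>Natural cutoffs permit induction on \<open>n\<close>; a real cutoff \<open>y\<close> is
  replaced by its floor in \<open>primes_real_le_conv\<close>.\<close>

definition primes_le :: "nat \<Rightarrow> nat set" where
  "primes_le n = {p. prime p \<and> p \<le> n}"

lemma finite_primes_le [simp]: "finite (primes_le n)"
  by (rule finite_subset[of _ "{..n}"]) (auto simp: primes_le_def)

lemma primes_le_0 [simp]: "primes_le 0 = {}"
  by (auto simp: primes_le_def)

lemma primes_le_1 [simp]: "primes_le (Suc 0) = {}"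
  by (auto simp: primes_le_def dest: prime_gt_1_nat)

lemma primes_le_Suc:
  "primes_le (Suc n) = (if prime (Suc n) then insert (Suc n) (primes_le n) else primes_le n)"
  by (auto simp: primes_le_def le_Suc_eq)

lemma Suc_notin_primes_le [simp]: "Suc n \<notin> primes_le n"
  by (auto simp: primes_le_def)

lemma sum_primes_le_Suc:
  fixes f :: "nat \<Rightarrow> 'a :: comm_monoid_add"
  shows "sum f (primes_le (Suc n)) = sum f (primes_le n) + (if prime (Suc n) then f (Suc n) else 0)"
  by (auto simp: primes_le_Suc add.commute)

section \<open>Chebyshev's upper bound and weighted sums over primes\<close>

lemma prime_prod_dvd_of_pairwise:
  fixes x :: nat
  assumes "finite A" "\<And>p. p \<in> A \<Longrightarrow> prime p" "\<And>p. p \<in> A \<Longrightarrow> p dvd x"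
  shows "\<Prod>A dvd x"
  using assms
proof (induction A rule: finite_induct)
  case (insert p A)
  have "coprime p (\<Prod>A)"
    using insert by (intro prod_coprime_right) (metis insertI1 insertI2 primes_coprime)
  with insert show ?case by (simp add: divides_mult)
qed simp

text \<open>The two middle coefficients of the row are equal, and together they are at most the row
  sum 2 * 4^m.\<close>

lemma choose_middle_le: "(2 * m + 1) choose m \<le> 4 ^ m"
proof -
  have "2 * ((2 * m + 1) choose m) = ((2 * m + 1) choose m) + ((2 * m + 1) choose (m + 1))"
    using binomial_symmetric[of m "2 * m + 1"] by simp
  also have "\<dots> = (\<Sum>k\<in>{m, m + 1}. (2 * m + 1) choose k)" by simp
  also have "\<dots> \<le> (\<Sum>k\<le>2 * m + 1. (2 * m + 1) choose k)"
    by (rule sum_mono2) auto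
  also have "\<dots> = 2 * 4 ^ m" by (simp only: choose_row_sum power_add power_mult) simp
  finally show ?thesis by simp
qed

definition theta :: "nat \<Rightarrow> real" where
  "theta n = (\<Sum>p\<in>primes_le n. ln (real p))"

lemma theta_Suc: "theta (Suc n) = theta n + (if prime (Suc n) then ln (real (Suc n)) else 0)"
  by (simp add: theta_def sum_primes_le_Suc)

text \<open>A prime in (m + 1, 2m + 1] divides (2m + 1)! but neither m! nor (m + 1)!, so it divides
  the middle binomial coefficient. Hence so does the product of all these primes, which is therefore
  at most 4^m.\<close>

lemma theta_odd_le: "theta (2 * m + 1) \<le> theta (m + 1) + real m * ln 4"
proof -
  let ?A = "primes_le (2 * m + 1) - primes_le (m + 1)"
  have dv: "p dvd ((2 * m + 1) choose m)" if "p \<in> ?A" for p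
  proof -
    from that have p: "prime p" "p > m + 1" "p \<le> 2 * m + 1" by (auto simp: primes_le_def)
    have "fact m * fact (m + 1) * ((2 * m + 1) choose m) = (fact (2 * m + 1) :: nat)"
      using binomial_fact_lemma[of m "2 * m + 1"] by (simp add: mult_2)
    moreover have "p dvd fact (2 * m + 1)" using p by (simp add: prime_dvd_fact_iff del: fact_Suc)
    ultimately have "p dvd fact m * fact (m + 1) * ((2 * m + 1) choose m)" by metis
    then show ?thesis using p by (simp add: prime_dvd_mult_iff prime_dvd_fact_iff del: fact_Suc)
  qed
  have "\<Prod>?A dvd ((2 * m + 1) choose m)"
    by (rule prime_prod_dvd_of_pairwise) (use dv in \<open>auto simp: primes_le_def\<close>)
  then have "\<Prod>?A \<le> (2 * m + 1) choose m"
    by (rule dvd_imp_le) (simp add: zero_less_binomial)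
  also have "\<dots> \<le> 4 ^ m" by (rule choose_middle_le)
  finally have "real (\<Prod>?A) \<le> 4 ^ m" by (metis of_nat_le_iff of_nat_numeral of_nat_power)
  moreover have "real (\<Prod>?A) > 0"
    by (simp only: of_nat_prod, rule prod_pos) (auto simp: primes_le_def prime_gt_0_nat)
  ultimately have "ln (real (\<Prod>?A)) \<le> ln (4 ^ m)" by (subst ln_le_cancel_iff) auto
  moreover have "ln (real (\<Prod>?A)) = (\<Sum>p\<in>?A. ln (real p))"
    by (simp only: of_nat_prod, subst ln_prod) (auto simp: primes_le_def prime_gt_0_nat)
  moreover have "theta (2 * m + 1) = (\<Sum>p\<in>?A. ln (real p)) + theta (m + 1)"
    unfolding theta_def by (rule sum.subset_diff) (auto simp: primes_le_def)
  ultimately show ?thesis by (simp add: ln_realpow)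
qed

text \<open>An even n > 2 adds no prime to those up to n - 1, and an odd n = 2m + 1 is reduced to m
  + 1 by \<open>theta_odd_le\<close>.\<close>

theorem theta_le: "theta n \<le> real n * ln 4"
proof (induction n rule: less_induct)
  case (less n)
  consider "n = 0" | "n = 1" | "n = 2" | "n > 2" "even n" | "n > 2" "odd n" by linarith
  then show ?case
  proof cases
    case 3
    have "theta 2 = ln 2"
      using theta_Suc[of 1] theta_Suc[of 0] by (simp add: theta_def primes_le_def numeral_2_eq_2[symmetric])
    moreover have "ln 2 \<le> 2 * ln (4::real)"
      using ln_le_cancel_iff[of 2 "4::real"] ln_gt_zero[of "4::real"] by linarith
    ultimately show ?thesis using 3 by simp
  next
    case 4
    then obtain m where m: "n = Suc m" by (cases n) auto
    have "\<not> prime n" using 4 by (metis nat_neq_iff primes_dvd_imp_eq two_is_prime_nat)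
    then have "theta n = theta m" using m theta_Suc[of m] by simp
    also have "\<dots> \<le> real m * ln 4" using less.IH[of m] m by simp
    also have "\<dots> \<le> real n * ln 4" using m by simp
    finally show ?thesis .
  next
    case 5
    then obtain m where m: "n = 2 * m + 1" by (auto elim: oddE)
    with 5 have "m + 1 < n" by simp
    from less.IH[OF this] theta_odd_le[of m] show ?thesis by (simp add: m algebra_simps)
  qed (auto simp: theta_def)
qed

lemma theta_nonneg [simp]: "theta n \<ge> 0"
  unfolding theta_def by (rule sum_nonneg) (auto simp: primes_le_def dest: prime_gt_0_nat)

text \<open>Passing from n to n + 1, a new prime p = n + 1 contributes ln 1 = 0, and every old
  summand grows by ln p * ln((n + 1)/n). The total growth is at most theta(n)/n, hence at most ln
  4.\<close>

lemma sum_ln_ln_le: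
  "(\<Sum>p\<in>primes_le n. ln (real p) * ln (real n / real p)) \<le> real n * ln 4"
proof (induction n)
  case (Suc n)
  show ?case
  proof (cases "n = 0")
    case False
    then have n: "n > 0" by simp
    have "(\<Sum>p\<in>primes_le (Suc n). ln (real p) * ln (real (Suc n) / real p)) =
          (\<Sum>p\<in>primes_le n. ln (real p) * ln (real (Suc n) / real p))"
      by (simp add: sum_primes_le_Suc)
    also have "\<dots> = (\<Sum>p\<in>primes_le n. ln (real p) * ln (real n / real p) +
                       ln (real p) * ln (real (Suc n) / real n))"
      by (rule sum.cong) (use n in \<open>auto simp: primes_le_def prime_gt_0_nat ln_div algebra_simps\<close>)
    also have "\<dots> = (\<Sum>p\<in>primes_le n. ln (real p) * ln (real n / real p))
                      + theta n * ln (real (Suc n) / real n)"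
      by (simp add: sum.distrib theta_def sum_distrib_right)
    also have "theta n * ln (real (Suc n) / real n) \<le> (real n * ln 4) * (1 / real n)"
    proof (rule mult_mono)
      have "real (Suc n) / real n = 1 + 1 / real n" using n by (simp add: field_simps)
      then show "ln (real (Suc n) / real n) \<le> 1 / real n"
        using ln_add_one_self_le_self[of "1 / real n"] by simp
      show "0 \<le> ln (real (Suc n) / real n)" using n by simp
    qed (use theta_le in auto)
    also have "\<dots> = ln 4" using n by simp
    finally show ?thesis using Suc.IH by (simp add: algebra_simps)
  qed simp
qed simp

text \<open>Partial summation against \<open>theta\<close>, carried out as an induction on N:
  theta(N)/N^2 is the boundary term, and theta(n) (1/n^2 - 1/(n+1)^2) is at most 2 ln 4 (1/n -
  1/(n+1)), which telescopes.\<close>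

lemma sum_inverse_square_gt_le:
  assumes "k \<ge> 1" "k \<le> N"
  shows "(\<Sum>p\<in>primes_le N - primes_le k. ln (real p) / real p ^ 2)
           \<le> theta N / real N ^ 2 + 2 * ln 4 * (1 / real k - 1 / real N)"
  using assms(2)
proof (induction N rule: dec_induct)
  case base
  show ?case by simp
next
  case (step n)
  have n: "n \<ge> 1" using step assms by simp
  let ?S = "\<lambda>n. \<Sum>p\<in>primes_le n - primes_le k. ln (real p) / real p ^ 2"
  have "primes_le (Suc n) - primes_le k =
     (if prime (Suc n) then insert (Suc n) (primes_le n - primes_le k) else primes_le n - primes_le k)"
    using step by (auto simp: primes_le_def le_Suc_eq)
  then have S: "?S (Suc n) = ?S n + (if prime (Suc n) then ln (real (Suc n)) / real (Suc n) ^ 2 else 0)"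
    by simp
  have "theta n / real n ^ 2 = theta n / real (Suc n) ^ 2 + theta n * (1 / real n ^ 2 - 1 / real (Suc n) ^ 2)"
    by (simp add: field_simps)
  also have "theta n * (1 / real n ^ 2 - 1 / real (Suc n) ^ 2)
       \<le> (real n * ln 4) * (1 / real n ^ 2 - 1 / real (Suc n) ^ 2)"
    using n by (intro mult_right_mono theta_le) (simp add: frac_le power_mono)
  also have "\<dots> = ln 4 * (real n * (1 / real n ^ 2 - 1 / real (Suc n) ^ 2))"
    by simp
  also have "\<dots> \<le> ln 4 * (2 * (1 / real n - 1 / real (Suc n)))"
  proof (rule mult_left_mono)
    have "real n * (1 / real n ^ 2 - 1 / real (Suc n) ^ 2) = (2 * real n + 1) / (real n * (real n + 1) ^ 2)"
      using n by (simp add: divide_simps) (simp add: power2_eq_square algebra_simps)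
    also have "\<dots> \<le> (2 * (real n + 1)) / (real n * (real n + 1) ^ 2)"
      using n by (intro divide_right_mono) auto
    also have "\<dots> = 2 * (1 / real n - 1 / real (Suc n))"
      using n by (simp add: divide_simps) (simp add: power2_eq_square algebra_simps)
    finally show "real n * (1 / real n ^ 2 - 1 / real (Suc n) ^ 2) \<le> 2 * (1 / real n - 1 / real (Suc n))" .
  qed simp
  finally have "theta n / real n ^ 2 \<le> theta n / real (Suc n) ^ 2 + 2 * ln 4 * (1 / real n - 1 / real (Suc n))"
    by (simp only: mult_ac)
  moreover have "theta (Suc n) / real (Suc n) ^ 2 = theta n / real (Suc n) ^ 2 +
       (if prime (Suc n) then ln (real (Suc n)) / real (Suc n) ^ 2 else 0)"
    by (simp add: theta_Suc add_divide_distrib)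
  ultimately show ?case using step.IH S by (simp add: algebra_simps)
qed

text \<open>Replacing \<open>1 / p\<^sup>2\<close> by \<open>ln p / p\<^sup>2\<close> gains the factor \<open>1 / ln k\<close>.\<close>

lemma sum_inverse_square_primes_le:
  assumes "k \<ge> 2" "finite S" "\<And>p. p \<in> S \<Longrightarrow> prime p \<and> k < p"
  shows "(\<Sum>p\<in>S. 1 / real p ^ 2) \<le> 3 * ln 4 / (real k * ln (real k))"
proof (cases "S = {}")
  case True
  then show ?thesis using assms by simp
next
  case False
  define N where "N = Max S"
  have N: "p \<in> S \<Longrightarrow> p \<le> N" for p using assms by (simp add: N_def)
  have kN: "k < N" using False assms(3) N by (metis N_def Max_in assms(2))
  have lnk: "ln (real k) > 0" using assms by simp
  have "ln (real k) * (\<Sum>p\<in>S. 1 / real p ^ 2) = (\<Sum>p\<in>S. ln (real k) / real p ^ 2)"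
    by (simp add: sum_distrib_left)
  also have "\<dots> \<le> (\<Sum>p\<in>S. ln (real p) / real p ^ 2)"
  proof (intro sum_mono divide_right_mono)
    fix p assume "p \<in> S"
    with assms have "k < p" by simp
    with assms(1) show "ln (real k) \<le> ln (real p)" by (subst ln_le_cancel_iff) auto
  qed auto
  also have "\<dots> \<le> (\<Sum>p\<in>primes_le N - primes_le k. ln (real p) / real p ^ 2)"
  proof (rule sum_mono2)
    show "S \<subseteq> primes_le N - primes_le k" using assms N by (force simp: primes_le_def)
  qed (auto simp: primes_le_def dest: prime_gt_0_nat)
  also have "\<dots> \<le> theta N / real N ^ 2 + 2 * ln 4 * (1 / real k - 1 / real N)"
    using assms kN by (intro sum_inverse_square_gt_le) auto
  also have "theta N / real N ^ 2 \<le> real N * ln 4 / real N ^ 2"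
    by (intro divide_right_mono theta_le) auto
  also have "\<dots> = ln 4 / real N" using kN by (simp add: power2_eq_square)
  also have "\<dots> \<le> ln 4 / real k" using kN assms by (intro divide_left_mono) auto
  also have "2 * ln 4 * (1 / real k - 1 / real N) \<le> 2 * ln 4 * (1 / real k)"
    by (intro mult_left_mono) auto
  finally have "ln (real k) * (\<Sum>p\<in>S. 1 / real p ^ 2) \<le> 3 * ln 4 / real k"
    by (simp add: field_simps)
  then show ?thesis using lnk assms by (simp add: field_simps)
qed

text \<open>Both factors are O(x^(1/4)). This makes sqrt k * (1 + ln k), the contribution of the
  primes up to sqrt k below, O(k / ln k).\<close>

lemma ln_quadratic_le_sqrt:
  fixes x :: real assumes "x \<ge> 1"
  shows "ln x * (1 + ln x) \<le> 20 * sqrt x"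
proof -
  have "ln x \<le> 4 * x powr (1/4)" using ln_powr_bound[of x "1/4"] assms by simp
  moreover have "1 \<le> x powr (1/4)" using assms by (simp add: ge_one_powr_ge_zero)
  ultimately have "ln x * (1 + ln x) \<le> (4 * x powr (1/4)) * (5 * x powr (1/4))"
    using assms by (intro mult_mono) auto
  also have "\<dots> = 20 * (x powr (1/4) * x powr (1/4))" by simp
  also have "x powr (1/4) * x powr (1/4) = sqrt x"
    using assms by (simp add: powr_add[symmetric] powr_half_sqrt)
  finally show ?thesis .
qed

text \<open>The primes below \<open>\<surd>k\<close> are negligible, and for the others \<open>ln p \<ge> (ln k) / 2\<close>
  introduces the weight \<open>ln p\<close> of \<^const>\<open>theta\<close>.\<close>

lemma sum_one_plus_ln_le:
  assumes "k \<ge> 2"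
  shows "(\<Sum>p\<in>primes_le k. 1 + ln (real k / real p)) \<le> (20 + 4 * ln 4) * real k / ln (real k)"
proof -
  define l where "l = ln (real k)"
  have l: "l > 0" using assms by (simp add: l_def)
  define A where "A = {p\<in>primes_le k. real p \<le> sqrt (real k)}"
  define B where "B = {p\<in>primes_le k. real p > sqrt (real k)}"
  have AB: "primes_le k = A \<union> B" "A \<inter> B = {}" "finite A" "finite B"
    by (auto simp: A_def B_def primes_le_def)
  have pos: "p > 0" "p \<le> k" "prime p" if "p \<in> primes_le k" for p
    using that by (auto simp: primes_le_def prime_gt_0_nat)
  have "A \<subseteq> {1..nat \<lfloor>sqrt (real k)\<rfloor>}"
    using pos by (auto simp: A_def le_nat_floor Suc_le_eq)
  then have "card A \<le> card {1..nat \<lfloor>sqrt (real k)\<rfloor>}" by (intro card_mono) auto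
  then have cA: "real (card A) \<le> sqrt (real k)"
    by simp (metis floor_of_nat le_floor_iff le_nat_iff of_int_of_nat_eq of_nat_0_le_iff real_sqrt_ge_zero zero_le_floor)
  have "(\<Sum>p\<in>A. 1 + ln (real k / real p)) \<le> (\<Sum>p\<in>A. 1 + l)"
  proof (rule sum_mono)
    fix p assume "p \<in> A"
    then have "p \<in> primes_le k" by (simp add: A_def)
    from pos[OF this] have "1 \<le> real p" "real p > 0" by auto
    then have "real k / real p \<le> real k" "real k / real p > 0"
      using assms by (auto simp: divide_le_eq)
    then show "1 + ln (real k / real p) \<le> 1 + l" using assms by (simp add: l_def)
  qed
  also have "\<dots> \<le> sqrt (real k) * (1 + l)"
    using cA l by (simp add: mult_right_mono)
  also have "\<dots> \<le> 20 * real k / l"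
  proof -
    have "sqrt (real k) * (1 + l) * l \<le> sqrt (real k) * (20 * sqrt (real k))"
      using ln_quadratic_le_sqrt[of "real k"] assms
      by (simp only: mult.assoc) (intro mult_left_mono, auto simp: l_def mult.commute)
    also have "\<dots> = 20 * real k" by simp
    finally show ?thesis using l by (simp add: field_simps)
  qed
  finally have 1: "(\<Sum>p\<in>A. 1 + ln (real k / real p)) \<le> 20 * real k / l" .
  have "(\<Sum>p\<in>B. 1 + ln (real k / real p)) \<le>
        (\<Sum>p\<in>B. 2 / l * (ln (real p) + ln (real p) * ln (real k / real p)))"
  proof (rule sum_mono)
    fix p assume p: "p \<in> B"
    then have p1: "p \<in> primes_le k" by (simp add: B_def)
    note pp = pos[OF p1]
    have "ln (sqrt (real k)) < ln (real p)" using p assms by (subst ln_less_cancel_iff) (auto simp: B_def pp)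
    then have "l / 2 \<le> ln (real p)" by (simp add: l_def ln_sqrt)
    then have "1 \<le> 2 / l * ln (real p)" using l by (simp add: field_simps)
    moreover have "0 \<le> 1 + ln (real k / real p)" using pp by (simp add: add_nonneg_nonneg)
    ultimately have "1 * (1 + ln (real k / real p)) \<le> (2 / l * ln (real p)) * (1 + ln (real k / real p))"
      by (rule mult_right_mono)
    then show "1 + ln (real k / real p) \<le> 2 / l * (ln (real p) + ln (real p) * ln (real k / real p))"
      by (simp add: algebra_simps add_divide_distrib)
  qed
  also have "\<dots> \<le> (\<Sum>p\<in>primes_le k. 2 / l * (ln (real p) + ln (real p) * ln (real k / real p)))"
  proof (rule sum_mono2)
    fix p assume "p \<in> primes_le k - B"
    then have "p \<in> primes_le k" by simp
    from pos[OF this] show "0 \<le> 2 / l * (ln (real p) + ln (real p) * ln (real k / real p))" using l by simp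
  qed (auto simp: AB)
  also have "\<dots> = 2 / l * (theta k + (\<Sum>p\<in>primes_le k. ln (real p) * ln (real k / real p)))"
    by (simp only: theta_def sum_distrib_left[symmetric] sum.distrib)
  also have "\<dots> \<le> 2 / l * (real k * ln 4 + real k * ln 4)"
    using l by (intro mult_left_mono add_mono theta_le sum_ln_ln_le) auto
  also have "\<dots> = 4 * ln 4 * real k / l" by simp
  finally have 2: "(\<Sum>p\<in>B. 1 + ln (real k / real p)) \<le> 4 * ln 4 * real k / l" .
  have "(\<Sum>p\<in>primes_le k. 1 + ln (real k / real p)) =
     (\<Sum>p\<in>A. 1 + ln (real k / real p)) + (\<Sum>p\<in>B. 1 + ln (real k / real p))"
    unfolding AB(1) using AB by (intro sum.union_disjoint) auto
  also have "\<dots> \<le> 20 * real k / l + 4 * ln 4 * real k / l" using 1 2 by linarith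
  also have "\<dots> = (20 + 4 * ln 4) * real k / l" by (simp add: add_divide_distrib distrib_right)
  finally show ?thesis by (simp add: l_def)
qed

section \<open>Mertens' first theorem\<close>

lemma ln_fact_conv_sum_mangoldt:
  "ln (fact n :: real) = (\<Sum>d\<in>{1..n}. mangoldt d * real (n div d))"
proof -
  have "ln (fact n :: real) = (\<Sum>m\<in>{1..n}. ln (real m))"
    unfolding fact_prod of_nat_prod by (rule ln_prod) auto
  also have "\<dots> = (\<Sum>m\<in>{1..n}. \<Sum>d | d \<in> {1..n} \<and> d dvd m. mangoldt d)"
  proof (rule sum.cong)
    fix m assume m: "m \<in> {1..n}"
    then have "ln (real m) = (\<Sum>d | d dvd m. mangoldt d)"
      using mangoldt_sum[of m, where 'a = real] by simp
    also have "{d. d dvd m} = {d. d \<in> {1..n} \<and> d dvd m}"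
      using m by (auto dest: dvd_imp_le simp: Suc_le_eq intro: Nat.gr0I)
    finally show "ln (real m) = (\<Sum>d | d \<in> {1..n} \<and> d dvd m. mangoldt d)" .
  qed simp
  also have "\<dots> = (\<Sum>d\<in>{1..n}. \<Sum>m | m \<in> {1..n} \<and> d dvd m. mangoldt d)"
    by (rule sum.swap_restrict) auto
  also have "\<dots> = (\<Sum>d\<in>{1..n}. mangoldt d * real (n div d))"
  proof (rule sum.cong)
    fix d assume d: "d \<in> {1..n}"
    have "{m. m \<in> {1..n} \<and> d dvd m} = (\<lambda>i. d * i) ` {1..n div d}"
    proof (intro equalityI subsetI)
      fix m assume "m \<in> {m. m \<in> {1..n} \<and> d dvd m}"
      then obtain i where "m = d * i" "1 \<le> d * i" "d * i \<le> n" by auto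
      then show "m \<in> (\<lambda>i. d * i) ` {1..n div d}"
        using d by (intro image_eqI[of _ _ i]) (auto simp: less_eq_div_iff_mult_less_eq mult.commute Suc_le_eq)
    qed (use d in \<open>auto simp: less_eq_div_iff_mult_less_eq mult.commute\<close>)
    moreover have "inj_on (\<lambda>i. d * i) {1..n div d}" using d by (auto simp: inj_on_def)
    ultimately have "card {m. m \<in> {1..n} \<and> d dvd m} = n div d" by (simp add: card_image)
    then show "(\<Sum>m | m \<in> {1..n} \<and> d dvd m. mangoldt d) = mangoldt d * real (n div d)"
      by (simp add: mult.commute)
  qed simp
  finally show ?thesis .
qed

text \<open>n^n / n! is a single term of the series of exp(n).\<close>

lemma ln_fact_ge: "ln (fact n :: real) \<ge> real n * ln (real n) - real n"
proof (cases "n = 0")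
  case False
  have "real n ^ n / fact n \<le> exp (real n)"
  proof -
    have "(\<Sum>k\<in>{n}. real n ^ k /\<^sub>R fact k) \<le> (\<Sum>k. real n ^ k /\<^sub>R fact k)"
      by (intro sum_le_suminf summable_exp_generic) auto
    then show ?thesis by (simp add: exp_def divide_inverse mult_ac)
  qed
  then have "ln (real n ^ n / fact n) \<le> real n"
    using False by (metis divide_pos_pos fact_gt_zero ln_exp ln_le_cancel_iff exp_gt_zero of_nat_0_less_iff zero_less_power gr0I)
  then show ?thesis using False by (simp add: ln_div ln_realpow)
qed simp

lemma ln_fact_le: "ln (fact n :: real) \<le> real n * ln (real n)"
proof (cases "n = 0")
  case False
  have "fact n \<le> real n ^ n" using fact_le_power[of n, where 'a = real] by simp
  then have "ln (fact n) \<le> ln (real n ^ n)" using False by (subst ln_le_cancel_iff) auto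
  then show ?thesis using False by (simp add: ln_realpow)
qed simp

text \<open>Only the powers p^j with j at least 2 contribute. For fixed p the geometric series in j
  gives at most 2 ln p / p^2, and these are summed by \<open>sum_inverse_square_gt_le\<close> with k
  = 1.\<close>

lemma sum_mangoldt_nonprime_le:
  "(\<Sum>d | d \<in> {1..n} \<and> \<not>prime d. mangoldt d / real d) \<le> 6 * ln (4 :: real)"
proof (cases "n = 0")
  case False
  \<comment> \<open>The index i encodes the exponent i + 2. The range i < n is large enough because
    an exponent j occurring in p^j \<le> n satisfies j < p^j.\<close>
  let ?I = "primes_le n \<times> {..<n}"
  have inj: "inj_on (\<lambda>(p, i). p ^ (i + 2)) ?I"
  proof (rule inj_onI, clarify)
    fix p i q j :: nat
    assume "p \<in> primes_le n" "q \<in> primes_le n" "p ^ (i + 2) = q ^ (j + 2)"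
    then show "p = q \<and> i = j"
      using prime_power_inj''[of p q "i + 2" "j + 2"] by (simp add: primes_le_def)
  qed
  have "(\<Sum>d | d \<in> {1..n} \<and> \<not>prime d. mangoldt d / real d) =
      (\<Sum>d | d \<in> {1..n} \<and> \<not>prime d \<and> mangoldt d / real d \<noteq> 0. mangoldt d / real d)"
    by (rule sum.mono_neutral_right) auto
  also have "\<dots> \<le> (\<Sum>d\<in>(\<lambda>(p, i). p ^ (i + 2)) ` ?I. mangoldt d / real d)"
  proof (rule sum_le_included[where i = "\<lambda>d. d"])
    show "\<forall>d\<in>{d. d \<in> {1..n} \<and> \<not>prime d \<and> mangoldt d / real d \<noteq> 0}.
       \<exists>y\<in>(\<lambda>(p, i). p ^ (i + 2)) ` ?I. y = d \<and> mangoldt d / real d \<le> mangoldt y / real y"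
    proof (clarify, intro bexI conjI refl order_refl)
      fix d assume d: "d \<in> {1..n}" "\<not>prime d" and pp: "mangoldt d / real d \<noteq> 0"
      then have "primepow d" by (simp add: mangoldt_def split: if_splits)
      then obtain p i where pi: "prime p" "i > 0" "d = p ^ i" unfolding primepow_def by blast
      then have "i \<noteq> 1" using d(2) by (metis power_one_right)
      define j where "j = i - 2"
      have j: "i = j + 2" using \<open>i \<noteq> 1\<close> pi(2) by (simp add: j_def)
      have "p ^ 1 \<le> p ^ i" using pi by (intro power_increasing) (auto simp: Suc_le_eq prime_gt_0_nat)
      moreover have "i < p ^ i" using power_gt_expt[of p i] prime_gt_1_nat[OF pi(1)] by simp
      ultimately have "(p, j) \<in> ?I" using d(1) pi(1) j unfolding pi(3)[symmetric] by (simp add: primes_le_def)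
      then show "d \<in> (\<lambda>(p, i). p ^ (i + 2)) ` ?I" unfolding pi(3) j by (rule rev_image_eqI) simp
    qed simp_all
  qed (auto simp: mangoldt_nonneg)
  also have "\<dots> = (\<Sum>(p, i)\<in>?I. ln (real p) / real p ^ (i + 2))"
    by (subst sum.reindex[OF inj], rule sum.cong)
       (auto simp: primes_le_def simp del: power_Suc power_Suc2)
  also have "\<dots> = (\<Sum>p\<in>primes_le n. \<Sum>i<n. ln (real p) / real p ^ (i + 2))"
    by (simp add: sum.cartesian_product)
  also have "\<dots> \<le> (\<Sum>p\<in>primes_le n. 2 * (ln (real p) / real p ^ 2))"
  proof (rule sum_mono)
    fix p assume "p \<in> primes_le n"
    then have p: "real p \<ge> 2" using prime_ge_2_nat[of p] by (auto simp: primes_le_def)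
    have "(\<Sum>i<n. (1 / real p) ^ i) \<le> 2"
    proof -
      have "(\<Sum>i<n. (1 / real p) ^ i) \<le> (\<Sum>i<n. (1 / 2) ^ i)"
        using p by (intro sum_mono power_mono) (auto simp: field_simps)
      also have "\<dots> \<le> 2" by (simp add: sum_gp_strict)
      finally show ?thesis .
    qed
    then have "ln (real p) / real p ^ 2 * (\<Sum>i<n. (1 / real p) ^ i) \<le> ln (real p) / real p ^ 2 * 2"
      using p by (intro mult_left_mono) auto
    also have "ln (real p) / real p ^ 2 * (\<Sum>i<n. (1 / real p) ^ i) = (\<Sum>i<n. ln (real p) / real p ^ (i + 2))"
      unfolding sum_distrib_left by (rule sum.cong) (simp_all add: power_inverse power2_eq_square divide_inverse)
    finally show "(\<Sum>i<n. ln (real p) / real p ^ (i + 2)) \<le> 2 * (ln (real p) / real p ^ 2)"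
      by (simp add: mult.commute)
  qed
  also have "\<dots> = 2 * (\<Sum>p\<in>primes_le n - primes_le 1. ln (real p) / real p ^ 2)"
    by (simp add: sum_distrib_left)
  also have "\<dots> \<le> 2 * (theta n / real n ^ 2 + 2 * ln 4 * (1 / real 1 - 1 / real n))"
    using False by (intro mult_left_mono sum_inverse_square_gt_le) auto
  also have "\<dots> \<le> 2 * (real n * ln 4 / real n ^ 2 + 2 * ln 4 * (1 / real 1 - 1 / real n))"
    by (intro mult_left_mono add_right_mono divide_right_mono theta_le) auto
  also have "2 * (real n * ln 4 / real n ^ 2 + 2 * ln 4 * (1 / real 1 - 1 / real n))
       = 2 * ln 4 * (2 - 1 / real n)"
    using False by (simp add: power2_eq_square field_simps)
  also have "\<dots> \<le> 2 * ln 4 * 2" by (intro mult_left_mono) auto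
  finally show ?thesis using ln_gt_zero[of "4::real"] by linarith
qed simp

text \<open>Both bounds compare ln n! with sums of \<open>mangoldt d * real (n div d)\<close>. From
  below, n div d \<le> n/d and the proper prime powers cost 6 ln 4; from above, only primes are kept
  and n div p \<ge> n/p - 1 costs theta(n) \<le> n ln 4.\<close>

theorem mertens_first_nat:
  assumes "n \<ge> 1"
  shows "\<bar>(\<Sum>p\<in>primes_le n. ln (real p) / real p) - ln (real n)\<bar> \<le> 1 + 6 * ln 4"
proof -
  let ?A = "\<Sum>p\<in>primes_le n. ln (real p) / real p"
  have split: "(\<Sum>d\<in>{1..n}. g d) = (\<Sum>p\<in>primes_le n. g p) + (\<Sum>d | d \<in> {1..n} \<and> \<not>prime d. g d)"
    for g :: "nat \<Rightarrow> real"
  proof -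
    have U: "{1..n} = primes_le n \<union> {d. d \<in> {1..n} \<and> \<not>prime d}"
      by (auto simp: primes_le_def Suc_le_eq prime_gt_0_nat)
    show ?thesis
      by (subst U, rule sum.union_disjoint) (auto simp: primes_le_def)
  qed
  have mp: "mangoldt p = ln (real p)" if "p \<in> primes_le n" for p
    using that by (simp add: primes_le_def)
  have "real n * ln (real n) - real n \<le> (\<Sum>d\<in>{1..n}. mangoldt d * real (n div d))"
    using ln_fact_ge[of n] by (simp add: ln_fact_conv_sum_mangoldt)
  also have "\<dots> \<le> (\<Sum>d\<in>{1..n}. real n * (mangoldt d / real d))"
  proof (rule sum_mono)
    fix d assume "d \<in> {1..n}"
    have "mangoldt d * real (n div d) \<le> mangoldt d * (real n / real d)"
      by (intro mult_left_mono of_nat_div_le_of_nat mangoldt_nonneg)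
    then show "mangoldt d * real (n div d) \<le> real n * (mangoldt d / real d)" by (simp add: mult.commute)
  qed
  also have "\<dots> = real n * (\<Sum>d\<in>{1..n}. mangoldt d / real d)" by (simp add: sum_distrib_left)
  also have "(\<Sum>d\<in>{1..n}. mangoldt d / real d) = ?A + (\<Sum>d | d \<in> {1..n} \<and> \<not>prime d. mangoldt d / real d)"
    by (subst split) (simp add: mp)
  also have "\<dots> \<le> ?A + 6 * ln 4" using sum_mangoldt_nonprime_le[of n] by simp
  finally have "real n * ln (real n) - real n \<le> real n * (?A + 6 * ln 4)"
    by (simp add: mult_left_mono)
  then have "real n * (ln (real n) - 1) \<le> real n * (?A + 6 * ln 4)"
    by (simp add: right_diff_distrib)
  then have lower: "ln (real n) - 1 \<le> ?A + 6 * ln 4" using assms by simp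
  have "real n * ?A - theta n = (\<Sum>p\<in>primes_le n. ln (real p) * (real n / real p - 1))"
    by (simp add: theta_def sum_distrib_left sum_subtractf right_diff_distrib mult.commute)
  also have "\<dots> \<le> (\<Sum>p\<in>primes_le n. mangoldt p * real (n div p))"
  proof (rule sum_mono)
    fix p assume p: "p \<in> primes_le n"
    then have p0: "p > 0" by (simp add: primes_le_def prime_gt_0_nat)
    have "n < p * (n div p) + p"
      using p0 by (metis add_less_cancel_left div_mult_mod_eq mod_less_divisor mult.commute)
    then have "real n < real p * real (n div p) + real p"
      by (metis of_nat_add of_nat_less_iff of_nat_mult)
    then have "real n / real p - 1 \<le> real (n div p)"
      using p0 by (simp add: field_simps)
    then show "ln (real p) * (real n / real p - 1) \<le> mangoldt p * real (n div p)"
      using p p0 by (simp add: mp mult_left_mono)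
  qed
  also have "\<dots> \<le> (\<Sum>d\<in>{1..n}. mangoldt d * real (n div d))"
    by (intro sum_mono2) (auto simp: primes_le_def Suc_le_eq prime_gt_0_nat mangoldt_nonneg)
  also have "\<dots> \<le> real n * ln (real n)"
    using ln_fact_le[of n] by (simp add: ln_fact_conv_sum_mangoldt)
  finally have "real n * ?A \<le> real n * (ln (real n) + ln 4)"
    using theta_le[of n] by (simp add: algebra_simps)
  then have "?A \<le> ln (real n) + ln 4" using assms by simp
  with lower show ?thesis using ln_gt_zero[of "4::real"] by linarith
qed

lemma primes_real_le_conv: "{p. prime p \<and> real p \<le> y} = primes_le (nat \<lfloor>y\<rfloor>)"
proof -
  have "real p \<le> y \<longleftrightarrow> p \<le> nat \<lfloor>y\<rfloor>" if "prime p" for p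
  proof -
    have "p \<le> nat z \<longleftrightarrow> int p \<le> z" for z using prime_gt_0_nat[OF that] by linarith
    then show ?thesis by (simp add: le_floor_iff)
  qed
  then show ?thesis by (auto simp: primes_le_def)
qed

text \<open>The constant for integer n, increased by 1 to cover ln y - ln(floor y) \<le> ln 2 \<le>
  1 for real y.\<close>

definition mertens_const :: real where
  "mertens_const = 2 + 6 * ln 4"

lemma mertens_const_pos: "mertens_const > 0"
  unfolding mertens_const_def by (intro add_pos_pos mult_pos_pos) auto

theorem mertens_first:
  assumes "y \<ge> 1"
  shows "\<bar>(\<Sum>p\<in>primes_le (nat \<lfloor>y\<rfloor>). ln (real p) / real p) - ln y\<bar> \<le> mertens_const"
proof -
  define n where "n = nat \<lfloor>y\<rfloor>"
  have n: "n \<ge> 1" "real n \<le> y" "y < real n + 1" using assms by (auto simp: n_def le_nat_iff)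
  have "y / real n \<le> 2" using n by (simp add: divide_le_eq)
  then have "ln (y / real n) \<le> ln 2" using n by (subst ln_le_cancel_iff) auto
  then have "ln y - ln (real n) \<le> ln 2" using n by (simp add: ln_div)
  moreover have "ln 2 \<le> (1 :: real)" using ln_le_minus_one[of "2 :: real"] by simp
  moreover have "ln (real n) \<le> ln y" using n by simp
  ultimately show ?thesis
    using mertens_first_nat[OF n(1)] unfolding n_def[symmetric] mertens_const_def by linarith
qed

section \<open>Sums over the primes between k and y\<close>

context
  fixes k :: nat and y :: real
  assumes k: "k \<ge> 2" "real k \<le> y"
begin

lemma primes_le_subset: "primes_le k \<subseteq> primes_le (nat \<lfloor>y\<rfloor>)"
  using k by (auto simp: primes_le_def le_nat_floor intro: le_trans)

lemma primes_between:
  assumes "p \<in> primes_le (nat \<lfloor>y\<rfloor>) - primes_le k"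
  shows "prime p" "k < p" "real p \<le> y"
  using assms primes_real_le_conv[of y] by (auto simp: primes_le_def)

lemma sum_ln_between:
  "\<bar>(\<Sum>p\<in>primes_le (nat \<lfloor>y\<rfloor>) - primes_le k. ln (real p) / real p) - (ln y - ln (real k))\<bar> \<le> 2 * mertens_const"
proof -
  have "(\<Sum>p\<in>primes_le (nat \<lfloor>y\<rfloor>) - primes_le k. ln (real p) / real p) =
     (\<Sum>p\<in>primes_le (nat \<lfloor>y\<rfloor>). ln (real p) / real p) - (\<Sum>p\<in>primes_le k. ln (real p) / real p)"
    by (intro sum_diff primes_le_subset) auto
  then show ?thesis using mertens_first[of y] mertens_first[of "real k"] k by simp
qed

text \<open>On this range ln k \<le> ln p \<le> ln y, so the sums of 1/p and of ln p / p differ by a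
  factor between ln k and ln y. The left inequality is used here and the right one in
  \<open>sum_inverse_between_ge\<close>.\<close>

lemma sum_inverse_between_le:
  "(\<Sum>p\<in>primes_le (nat \<lfloor>y\<rfloor>) - primes_le k. 1 / real p) \<le> (ln y - ln (real k) + 2 * mertens_const) / ln (real k)"
proof -
  have "ln (real k) * (\<Sum>p\<in>primes_le (nat \<lfloor>y\<rfloor>) - primes_le k. 1 / real p)
     \<le> (\<Sum>p\<in>primes_le (nat \<lfloor>y\<rfloor>) - primes_le k. ln (real p) / real p)"
    unfolding sum_distrib_left
  proof (rule sum_mono)
    fix p assume p: "p \<in> primes_le (nat \<lfloor>y\<rfloor>) - primes_le k"
    have "ln (real k) \<le> ln (real p)" using k primes_between[OF p] by (subst ln_le_cancel_iff) auto
    then show "ln (real k) * (1 / real p) \<le> ln (real p) / real p" by (simp add: divide_right_mono)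
  qed
  also have "\<dots> \<le> ln y - ln (real k) + 2 * mertens_const" using sum_ln_between by linarith
  finally show ?thesis using k by (simp add: field_simps)
qed

lemma sum_inverse_between_ge:
  "(ln y - ln (real k) - 2 * mertens_const) / ln y \<le> (\<Sum>p\<in>primes_le (nat \<lfloor>y\<rfloor>) - primes_le k. 1 / real p)"
proof -
  have "ln y - ln (real k) - 2 * mertens_const \<le> (\<Sum>p\<in>primes_le (nat \<lfloor>y\<rfloor>) - primes_le k. ln (real p) / real p)"
    using sum_ln_between by linarith
  also have "\<dots> \<le> ln y * (\<Sum>p\<in>primes_le (nat \<lfloor>y\<rfloor>) - primes_le k. 1 / real p)"
    unfolding sum_distrib_left
  proof (rule sum_mono)
    fix p assume p: "p \<in> primes_le (nat \<lfloor>y\<rfloor>) - primes_le k"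
    have "ln (real p) \<le> ln y" using k primes_between[OF p] by (subst ln_le_cancel_iff) auto
    then show "ln (real p) / real p \<le> ln y * (1 / real p)" by (simp add: divide_right_mono)
  qed
  finally show ?thesis using k by (simp add: field_simps)
qed

end

text \<open>Primes above exp(1/\<epsilon>) satisfy 1/p \<le> \<epsilon> ln p / p and are covered by
  Mertens' first theorem; the finitely many others go into C. The free \<epsilon> lets the
  off-diagonal estimate keep this sum below a small multiple of ln y.\<close>

lemma sum_inverse_primes_le:
  assumes "\<epsilon> > 0"
  obtains C where "C \<ge> 0" "\<And>y. y \<ge> 1 \<Longrightarrow> (\<Sum>p\<in>primes_le (nat \<lfloor>y\<rfloor>). 1 / real p) \<le> \<epsilon> * ln y + C"
proof -
  obtain N :: nat where N: "real N \<ge> exp (1 / \<epsilon>)" using real_arch_simple by blast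
  define C where "C = (\<Sum>p\<in>primes_le N. 1 / real p) + \<epsilon> * mertens_const"
  have "C \<ge> 0" using assms mertens_const_pos by (auto simp: C_def intro!: add_nonneg_nonneg sum_nonneg)
  moreover have "(\<Sum>p\<in>primes_le (nat \<lfloor>y\<rfloor>). 1 / real p) \<le> \<epsilon> * ln y + C" if y: "y \<ge> 1" for y
  proof -
    let ?P = "primes_le (nat \<lfloor>y\<rfloor>)"
    have "(\<Sum>p\<in>?P. 1 / real p) \<le> (\<Sum>p\<in>?P. (if p \<in> primes_le N then 1 / real p else 0) + \<epsilon> * (ln (real p) / real p))"
    proof (rule sum_mono)
      fix p assume "p \<in> ?P"
      then have p: "prime p" "p > 0" by (auto simp: primes_le_def prime_gt_0_nat)
      have nn: "0 \<le> \<epsilon> * (ln (real p) / real p)" using p assms by simp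
      show "1 / real p \<le> (if p \<in> primes_le N then 1 / real p else 0) + \<epsilon> * (ln (real p) / real p)"
      proof (cases "p \<in> primes_le N")
        case False
        then have "exp (1 / \<epsilon>) \<le> real p" using p N by (simp add: primes_le_def)
        then have "1 / \<epsilon> \<le> ln (real p)" using p by (subst ln_ge_iff) auto
        then have "1 \<le> \<epsilon> * ln (real p)" using assms by (simp add: field_simps)
        then have "1 / real p \<le> (\<epsilon> * ln (real p)) / real p" by (intro divide_right_mono) auto
        then show ?thesis using False by simp
      qed (use nn in auto)
    qed
    also have "\<dots> = (\<Sum>p\<in>?P \<inter> primes_le N. 1 / real p) + \<epsilon> * (\<Sum>p\<in>?P. ln (real p) / real p)"
      by (simp add: sum.distrib sum_distrib_left sum.inter_restrict)
    also have "\<dots> \<le> (\<Sum>p\<in>primes_le N. 1 / real p) + \<epsilon> * (ln y + mertens_const)"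
      using mertens_first[OF y] assms by (intro add_mono sum_mono2 mult_left_mono) auto
    finally show ?thesis by (simp add: C_def algebra_simps)
  qed
  ultimately show ?thesis using that by blast
qed

section \<open>Comparison of R_k with R\<close>

definition rprod :: "nat set \<Rightarrow> real" where
  "rprod A = (\<Prod>p\<in>A. inverse (1 - 1 / real p))"

lemma euler_R_conv_rprod: "euler_R y = rprod (primes_le (nat \<lfloor>y\<rfloor>))"
  by (simp add: euler_R_def rprod_def primes_real_le_conv)

lemma rprod_ge_1:
  assumes "\<And>p. p \<in> A \<Longrightarrow> prime p"
  shows "rprod A \<ge> 1"
  unfolding rprod_def
proof (rule prod_ge_1)
  fix p assume "p \<in> A"
  then have "real p > 1" using assms prime_gt_1_nat by auto
  then show "1 \<le> inverse (1 - 1 / real p)" by (simp add: field_simps)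
qed

lemma inverse_one_minus_le_exp:
  fixes x :: real
  assumes "0 \<le> x" "x \<le> 1 / 2"
  shows "inverse (1 - x) \<le> exp (2 * x)"
proof -
  have "2 * x * x \<le> 1 * x" using assms by (intro mult_right_mono) auto
  then have "1 \<le> (1 + 2 * x) * (1 - x)" by (simp add: algebra_simps)
  then have "inverse (1 - x) \<le> 1 + 2 * x" using assms by (simp add: field_simps)
  then show ?thesis using exp_ge_add_one_self[of "2 * x"] by linarith
qed

lemma prod_le_exp_sum:
  fixes g h :: "'a \<Rightarrow> real"
  assumes "finite A" "\<And>x. x \<in> A \<Longrightarrow> 0 \<le> g x" "\<And>x. x \<in> A \<Longrightarrow> g x \<le> exp (h x)"
  shows "prod g A \<le> exp (sum h A)"
  using assms by (subst exp_sum) (auto intro!: prod_mono)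

context
  fixes k :: nat and y :: real
  assumes k: "k \<ge> 2" "real k \<le> y"
begin

lemma rprod_ratio:
  "rprod (primes_le k) = rprod (primes_le (nat \<lfloor>y\<rfloor>)) * (\<Prod>p\<in>primes_le (nat \<lfloor>y\<rfloor>) - primes_le k. 1 - 1 / real p)"
proof -
  let ?S = "primes_le (nat \<lfloor>y\<rfloor>) - primes_le k"
  have "rprod (primes_le (nat \<lfloor>y\<rfloor>)) = rprod ?S * rprod (primes_le k)"
    unfolding rprod_def by (rule prod.subset_diff) (use primes_le_subset[OF k] in auto)
  moreover have "rprod ?S * (\<Prod>p\<in>?S. 1 - 1 / real p) = 1"
    unfolding rprod_def prod.distrib[symmetric]
  proof (rule prod.neutral, rule ballI)
    fix p assume "p \<in> ?S"
    then have "real p > 1" using prime_gt_1_nat by (auto simp: primes_le_def)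
    then show "inverse (1 - 1 / real p) * (1 - 1 / real p) = 1" by (simp add: field_simps)
  qed
  ultimately show ?thesis by (simp add: mult_ac)
qed

lemma prod_between_le:
  "(\<Prod>p\<in>primes_le (nat \<lfloor>y\<rfloor>) - primes_le k. 1 - 1 / real p)
     \<le> exp (- (\<Sum>p\<in>primes_le (nat \<lfloor>y\<rfloor>) - primes_le k. 1 / real p))"
  unfolding sum_negf[symmetric]
proof (rule prod_le_exp_sum)
  fix p assume "p \<in> primes_le (nat \<lfloor>y\<rfloor>) - primes_le k"
  then have "real p > 1" using prime_gt_1_nat by (auto simp: primes_le_def)
  then show "0 \<le> 1 - 1 / real p" by simp
  show "1 - 1 / real p \<le> exp (- (1 / real p))" using exp_ge_add_one_self[of "- (1 / real p)"] by simp
qed auto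

text \<open>Since 1/p \<le> 1/2, ln(1 - 1/p) \<ge> -1/p - 2/p^2, and the squares sum to O(1/(k ln
  k)) over p > k.\<close>

lemma prod_between_ge:
  "exp (- (\<Sum>p\<in>primes_le (nat \<lfloor>y\<rfloor>) - primes_le k. 1 / real p) - 6 * ln 4 / (real k * ln (real k)))
     \<le> (\<Prod>p\<in>primes_le (nat \<lfloor>y\<rfloor>) - primes_le k. 1 - 1 / real p)"
proof -
  let ?S = "primes_le (nat \<lfloor>y\<rfloor>) - primes_le k"
  have "(\<Sum>p\<in>?S. 1 / real p ^ 2) \<le> 3 * ln 4 / (real k * ln (real k))"
    using k primes_between[OF k] by (intro sum_inverse_square_primes_le) auto
  moreover have "(\<Sum>p\<in>?S. 2 * (1 / real p) ^ 2) = 2 * (\<Sum>p\<in>?S. 1 / real p ^ 2)"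
    by (simp add: sum_distrib_left power_divide)
  ultimately have "exp (- (\<Sum>p\<in>?S. 1 / real p) - 6 * ln 4 / (real k * ln (real k)))
      \<le> exp (\<Sum>p\<in>?S. - (1 / real p) - 2 * (1 / real p) ^ 2)"
    by (simp add: sum_subtractf sum_negf)
  also have "\<dots> = (\<Prod>p\<in>?S. exp (- (1 / real p) - 2 * (1 / real p) ^ 2))" by (simp add: exp_sum)
  also have "\<dots> \<le> (\<Prod>p\<in>?S. 1 - 1 / real p)"
  proof (rule prod_mono)
    fix p assume "p \<in> ?S"
    then have "real p \<ge> 2" using prime_ge_2_nat[of p] by (auto simp: primes_le_def)
    then have p: "0 \<le> 1 / real p" "1 / real p \<le> 1 / 2" by (auto simp: field_simps)
    then have "- (1 / real p) - 2 * (1 / real p) ^ 2 \<le> ln (1 - 1 / real p)"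
      by (intro ln_one_minus_pos_lower_bound)
    then show "0 \<le> exp (- (1 / real p) - 2 * (1 / real p) ^ 2) \<and> exp (- (1 / real p) - 2 * (1 / real p) ^ 2) \<le> 1 - 1 / real p"
      using p by (subst (asm) ln_ge_iff) auto
  qed
  finally show ?thesis .
qed

text \<open>This product majorises the diagonal in the upper bound. As p > k \<ge> 2, k/p^2 \<le>
  1/2, so its logarithm is at most 2k times the sum of 1/p^2, that is O(1/ln k); the k-th power then
  costs O(k/ln k) in the exponent.\<close>

lemma prod_inverse_square_between_le:
  "(\<Prod>p\<in>primes_le (nat \<lfloor>y\<rfloor>) - primes_le k. inverse (1 - real k / real p ^ 2)) ^ k
     \<le> exp (6 * ln 4 * (real k / ln (real k)))"
proof -
  let ?S = "primes_le (nat \<lfloor>y\<rfloor>) - primes_le k"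
  have p: "0 \<le> real k / real p ^ 2 \<and> real k / real p ^ 2 \<le> 1 / 2" if "p \<in> ?S" for p
  proof -
    have "2 * real k \<le> real p * real p" using primes_between[OF k that] k by (intro mult_mono) auto
    then show ?thesis using primes_between[OF k that] by (simp add: field_simps power2_eq_square)
  qed
  have pos: "0 \<le> inverse (1 - real k / real p ^ 2)" if "p \<in> ?S" for p
    unfolding inverse_nonnegative_iff_nonnegative using p[OF that] by linarith
  have "(\<Prod>p\<in>?S. inverse (1 - real k / real p ^ 2)) \<le> exp (\<Sum>p\<in>?S. 2 * (real k / real p ^ 2))"
    using p pos by (intro prod_le_exp_sum inverse_one_minus_le_exp) auto
  also have "(\<Sum>p\<in>?S. 2 * (real k / real p ^ 2)) = 2 * real k * (\<Sum>p\<in>?S. 1 / real p ^ 2)"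
    by (simp add: sum_distrib_left)
  also have "exp \<dots> \<le> exp (2 * real k * (3 * ln 4 / (real k * ln (real k))))"
    unfolding exp_le_cancel_iff
    using k primes_between[OF k] by (intro mult_left_mono sum_inverse_square_primes_le) auto
  also have "2 * real k * (3 * ln 4 / (real k * ln (real k))) = 6 * ln 4 / ln (real k)" using k by simp
  finally have "(\<Prod>p\<in>?S. inverse (1 - real k / real p ^ 2)) ^ k \<le> exp (6 * ln 4 / ln (real k)) ^ k"
    using pos by (intro power_mono prod_nonneg) auto
  then show ?thesis by (simp add: exp_of_nat_mult[symmetric] mult.commute)
qed

end

section \<open>The test weights 1 - p/(2k) on the primes up to k\<close>

definition reson_const :: real where
  "reson_const = 20 + 4 * ln 4"

lemma reson_const_pos: "reson_const > 0"
  unfolding reson_const_def by (intro add_pos_pos mult_pos_pos) auto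

text \<open>With x = p/(2k) \<le> 1/2 one has 1 - (1 - x)^2 \<ge> x, so each factor is at most 2k/p
  \<le> exp(1 + ln(k/p)), and \<open>sum_one_plus_ln_le\<close> sums the exponents.\<close>

lemma resonator_norm_le:
  assumes "k \<ge> 2"
  shows "(\<Prod>p\<in>primes_le k. inverse (1 - (1 - real p / (2 * real k)) ^ 2)) \<le> exp (reson_const * (real k / ln (real k)))"
proof -
  have 1: "0 \<le> inverse (1 - (1 - real p / (2 * real k)) ^ 2) \<and>
        inverse (1 - (1 - real p / (2 * real k)) ^ 2) \<le> exp (1 + ln (real k / real p))"
    if "p \<in> primes_le k" for p
  proof -
    have p: "0 < real p" "real p \<le> real k" using that by (auto simp: primes_le_def prime_gt_0_nat)
    define x where "x = real p / (2 * real k)"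
    have x: "0 < x" "x \<le> 1 / 2" using p by (auto simp: x_def field_simps)
    then have "x * x \<le> x * 1" by (intro mult_left_mono) auto
    then have "x \<le> 1 - (1 - x) ^ 2" by (simp add: power2_eq_square algebra_simps)
    moreover from this x have "inverse (1 - (1 - x) ^ 2) \<le> inverse x" by (intro le_imp_inverse_le) auto
    moreover have "inverse x = 2 * (real k / real p)" by (simp add: x_def)
    moreover have "\<dots> \<le> exp 1 * (real k / real p)"
      using exp_ge_add_one_self[of 1] p by (intro mult_right_mono) auto
    moreover have "\<dots> = exp (1 + ln (real k / real p))" using p by (simp add: exp_add)
    ultimately show ?thesis using x unfolding x_def[symmetric] by auto
  qed
  have "(\<Prod>p\<in>primes_le k. inverse (1 - (1 - real p / (2 * real k)) ^ 2)) \<le> exp (\<Sum>p\<in>primes_le k. 1 + ln (real k / real p))"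
    using 1 by (intro prod_le_exp_sum) auto
  also have "\<dots> \<le> exp (reson_const * (real k / ln (real k)))"
    using sum_one_plus_ln_le[OF assms] by (simp add: reson_const_def)
  finally show ?thesis .
qed

text \<open>Replacing the weight 1 by 1 - p/(2k) costs each Euler factor at most exp(-2/k), and
  there are O(k/ln k) primes up to k. The loss exp(-O(1/ln k)) stays admissible after raising to the
  power 2k.\<close>

lemma resonator_value_ge:
  assumes "k \<ge> 2"
  shows "rprod (primes_le k) * exp (- 2 * reson_const / ln (real k))
           \<le> (\<Prod>p\<in>primes_le k. inverse (1 - (1 - real p / (2 * real k)) / real p))"
proof -
  have tm: "0 \<le> inverse (1 - 1 / real p) * exp (- 2 / real k) \<and>
     inverse (1 - 1 / real p) * exp (- 2 / real k) \<le> inverse (1 - (1 - real p / (2 * real k)) / real p)"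
    if "p \<in> primes_le k" for p
  proof -
    have p: "real p \<ge> 2" using that prime_ge_2_nat[of p] by (auto simp: primes_le_def)
    have k: "real k \<ge> 2" using assms by simp
    have "inverse (1 - 1 / real k) \<le> exp (2 * (1 / real k))"
      using k by (intro inverse_one_minus_le_exp) (auto simp: field_simps)
    then have "inverse (exp (2 * (1 / real k))) \<le> inverse (inverse (1 - 1 / real k))"
      using k by (intro le_imp_inverse_le) auto
    then have "exp (- 2 / real k) \<le> 1 - 1 / real k" by (simp add: exp_minus)
    then have "inverse (1 - 1 / real p) * exp (- 2 / real k) \<le> inverse (1 - 1 / real p) * (1 - 1 / real k)"
      using p by (intro mult_left_mono) auto
    also have "\<dots> \<le> inverse (1 - (1 - real p / (2 * real k)) / real p)"
    proof -
      define q where "q = 1 - (1 - real p / (2 * real k)) / real p"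
      \<comment> \<open>The weight raises the denominator by exactly 1/(2k), independently of p.
        Since 1 - 1/p \<ge> 1/2, this is a relative change of at most 1/k.\<close>
      have q: "q = (1 - 1 / real p) + 1 / (2 * real k)" using p k by (simp add: q_def field_simps)
      have "1 / (2 * real k) \<le> (1 - 1 / real p) * (1 / real k)"
        using p k by (simp add: field_simps)
      moreover have "0 \<le> (1 / real k) * (1 / (2 * real k))" by simp
      moreover have "(1 - w) * (X + z) \<le> X" if "z \<le> X * w" "0 \<le> w * z" for w X z :: real
        using that by (simp add: algebra_simps)
      ultimately have "(1 - 1 / real k) * q \<le> 1 - 1 / real p"
        unfolding q by blast
      moreover have "q > 0" "1 - 1 / real p > 0" using p k by (auto simp: q add_pos_pos)
      ultimately show ?thesis unfolding q_def[symmetric] by (simp add: field_simps)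
    qed
    finally show ?thesis using p by simp
  qed
  \<comment> \<open>ln(k/p) \<ge> 0, so the earlier sum also counts the primes up to k.\<close>
  have "real (card (primes_le k)) = (\<Sum>p\<in>primes_le k. 1)" by simp
  also have "\<dots> \<le> (\<Sum>p\<in>primes_le k. 1 + ln (real k / real p))"
    by (intro sum_mono) (auto simp: primes_le_def prime_gt_0_nat)
  also have "\<dots> \<le> reson_const * real k / ln (real k)"
    using sum_one_plus_ln_le[OF assms] by (simp add: reson_const_def)
  finally have "2 / real k * real (card (primes_le k)) \<le> 2 / real k * (reson_const * real k / ln (real k))"
    by (intro mult_left_mono) auto
  then have "- 2 * reson_const / ln (real k) \<le> real (card (primes_le k)) * (- 2 / real k)"
    using assms by (simp add: field_simps)
  then have "exp (- 2 * reson_const / ln (real k)) \<le> exp (- 2 / real k) ^ card (primes_le k)"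
    unfolding exp_of_nat_mult[symmetric] by simp
  then have "rprod (primes_le k) * exp (- 2 * reson_const / ln (real k))
      \<le> rprod (primes_le k) * exp (- 2 / real k) ^ card (primes_le k)"
    using rprod_ge_1[of "primes_le k"] by (intro mult_left_mono) (auto simp: primes_le_def)
  also have "\<dots> = (\<Prod>p\<in>primes_le k. inverse (1 - 1 / real p) * exp (- 2 / real k))"
    by (simp add: rprod_def prod.distrib)
  also have "\<dots> \<le> (\<Prod>p\<in>primes_le k. inverse (1 - (1 - real p / (2 * real k)) / real p))"
    using tm by (intro prod_mono) auto
  finally show ?thesis .
qed

section \<open>Size of the off-diagonal terms\<close>

definition qprod :: "real \<Rightarrow> nat set \<Rightarrow> real" where
  "qprod \<sigma> S = (\<Prod>p\<in>S. inverse (1 - real p powr \<sigma> / real p))"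

text \<open>\<open>qprod\<close> is the Euler product of the series shifted by n^\<sigma>, as in
  Rankin's method. The shift \<sigma> = 1/(2 ln y) keeps p^\<sigma> \<le> exp(1/2) for all p \<le>
  y, so every factor remains comparable to 1 + O(1/p).\<close>

lemma qprod_factor:
  assumes "y \<ge> 2" "p \<in> primes_le (nat \<lfloor>y\<rfloor>)"
  defines "x \<equiv> real p powr (1 / (2 * ln y)) / real p"
  shows "1 \<le> inverse (1 - x)" "inverse (1 - x) \<le> exp (12 * (1 / real p))"
proof -
  have p: "prime p" "real p \<le> y" using assms(2) primes_real_le_conv[of y] by auto
  then have p2: "real p \<ge> 2" using prime_ge_2_nat[of p] by simp
  have "real p powr (1 / (2 * ln y)) \<le> y powr (1 / (2 * ln y))" using p assms(1) by (intro powr_mono2) auto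
  also have "\<dots> = exp (1 / 2)" using assms(1) by (simp add: powr_def)
  \<comment> \<open>A numerical value below 2 is essential for convergence at p = 2.\<close>
  also have "\<dots> \<le> 33 / 20"
  proof -
    have "exp (1 / 2) ^ 2 = exp (1 :: real)" by (simp add: power2_eq_square exp_add[symmetric])
    then have "exp (1 / 2) ^ 2 \<le> (33 / 20 :: real) ^ 2"
      using e_less_272 by (simp add: power2_eq_square)
    then show ?thesis by (rule power2_le_imp_le) simp
  qed
  finally have e: "real p powr (1 / (2 * ln y)) \<le> 33 / 20" .
  then have "x \<le> (33 / 20) / real p" unfolding x_def by (intro divide_right_mono) auto
  moreover have "(33 / 20) / real p \<le> (33 / 20) / 2" using p2 by (intro divide_left_mono) auto
  ultimately have x: "x \<le> 2 / real p" "x \<le> 33 / 40" "0 \<le> x" using p2 by (auto simp: x_def field_simps)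
  show "1 \<le> inverse (1 - x)" using x by (simp add: field_simps)
  \<comment> \<open>33/40 < 5/6, and x \<le> 5/6 is exactly what (1 + 6x)(1 - x) \<ge> 1
    requires.\<close>
  have "6 * x * x \<le> 5 * x" using x by (intro mult_right_mono) auto
  then have "1 \<le> (1 + 6 * x) * (1 - x)" by (simp add: algebra_simps)
  then have "inverse (1 - x) \<le> 1 + 6 * x" using x by (simp add: field_simps)
  also have "\<dots> \<le> exp (6 * x)" by (rule exp_ge_add_one_self)
  also have "\<dots> \<le> exp (12 * (1 / real p))" using x by simp
  finally show "inverse (1 - x) \<le> exp (12 * (1 / real p))" .
qed

lemma qprod_mono:
  assumes "y \<ge> 2" "S \<subseteq> primes_le (nat \<lfloor>y\<rfloor>)"
  shows "0 \<le> qprod (1 / (2 * ln y)) S" "qprod (1 / (2 * ln y)) S \<le> qprod (1 / (2 * ln y)) (primes_le (nat \<lfloor>y\<rfloor>))"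
  unfolding qprod_def
proof -
  have 1: "0 \<le> inverse (1 - real p powr (1 / (2 * ln y)) / real p)"
      "1 \<le> inverse (1 - real p powr (1 / (2 * ln y)) / real p)" if "p \<in> primes_le (nat \<lfloor>y\<rfloor>)" for p
    using qprod_factor(1)[OF assms(1) that] by linarith+
  show "0 \<le> (\<Prod>p\<in>S. inverse (1 - real p powr (1 / (2 * ln y)) / real p))"
    using 1(1) assms(2) by (intro prod_nonneg) blast
  show "(\<Prod>p\<in>S. inverse (1 - real p powr (1 / (2 * ln y)) / real p))
      \<le> (\<Prod>p\<in>primes_le (nat \<lfloor>y\<rfloor>). inverse (1 - real p powr (1 / (2 * ln y)) / real p))"
    using 1 assms(2) by (intro prod_mono2) (auto simp: subset_iff simp del: inverse_nonnegative_iff_nonnegative)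
qed

lemma one_plus_qprod_le:
  assumes "y \<ge> 2"
  shows "1 + qprod (1 / (2 * ln y)) (primes_le (nat \<lfloor>y\<rfloor>)) \<le> exp (1 + 12 * (\<Sum>p\<in>primes_le (nat \<lfloor>y\<rfloor>). 1 / real p))"
proof -
  let ?s = "\<Sum>p\<in>primes_le (nat \<lfloor>y\<rfloor>). 1 / real p"
  have "qprod (1 / (2 * ln y)) (primes_le (nat \<lfloor>y\<rfloor>)) \<le> exp (\<Sum>p\<in>primes_le (nat \<lfloor>y\<rfloor>). 12 * (1 / real p))"
    unfolding qprod_def
  proof (rule prod_le_exp_sum)
    fix p assume "p \<in> primes_le (nat \<lfloor>y\<rfloor>)"
    from qprod_factor[OF assms this]
    show "0 \<le> inverse (1 - real p powr (1 / (2 * ln y)) / real p)"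
      "inverse (1 - real p powr (1 / (2 * ln y)) / real p) \<le> exp (12 * (1 / real p))" by linarith+
  qed simp
  then have "qprod (1 / (2 * ln y)) (primes_le (nat \<lfloor>y\<rfloor>)) \<le> exp (12 * ?s)"
    by (simp add: sum_distrib_left)
  moreover have "1 \<le> exp (12 * ?s)" by (simp add: sum_nonneg)
  moreover have "2 * exp (12 * ?s) \<le> exp 1 * exp (12 * ?s)"
    using exp_ge_add_one_self[of 1] by (intro mult_right_mono) auto
  ultimately show ?thesis unfolding exp_add by linarith
qed

text \<open>With \<sigma> = 1/(2 ln y) and ln T \<ge> y \<ge> k (ln y)^2, the factor T^(-\<sigma>)
  saves exp(-k ln y / 2), while the Euler product costs exp(2k(1 + 12s)), where s is the sum of 1/p
  over p \<le> y. As s is a small multiple of ln y plus O(1), the saving wins for large y. For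
  bounded y, k is bounded too and a large T suffices.\<close>

lemma off_diagonal_small:
  "\<exists>T0\<ge>1. \<forall>T\<ge>T0. \<forall>y k. 2 \<le> y \<longrightarrow> y \<le> ln T \<longrightarrow> 2 \<le> k \<longrightarrow> real k \<le> y / (ln y)\<^sup>2 \<longrightarrow>
     (2 / T) powr (1 / (2 * ln y)) * (1 + qprod (1 / (2 * ln y)) (primes_le (nat \<lfloor>y\<rfloor>))) ^ (2 * k) \<le> 1 / 2"
proof -
  \<comment> \<open>1/96 gives 24s \<le> (ln y)/4 + 24C, half of the available saving (ln
    y)/2.\<close>
  obtain C where C: "C \<ge> 0" "\<And>y. y \<ge> 1 \<Longrightarrow> (\<Sum>p\<in>primes_le (nat \<lfloor>y\<rfloor>). 1 / real p) \<le> 1 / 96 * ln y + C"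
    by (rule sum_inverse_primes_le[of "1 / 96"]) auto
  \<comment> \<open>The threshold at which 2 + 24C - (ln y)/4 \<le> -1.\<close>
  define Y0 where "Y0 = exp (12 + 96 * C)"
  have lnY0: "ln Y0 = 12 + 96 * C" by (simp add: Y0_def)
  \<comment> \<open>For y < Y0 one has k \<le> 3 Y0 because ln y \<ge> 2/3; this T0 makes \<sigma>
    ln T exceed the resulting bound for 2k(1 + 12s) by at least 2.\<close>
  define T0 where "T0 = exp (2 * ln Y0 * (2 + 6 * Y0 * (1 + 12 * (1 / 96 * ln Y0 + C))))"
  have Y0: "Y0 > 0" "ln Y0 > 0" using C(1) by (auto simp: Y0_def)
  have "T0 \<ge> 1" unfolding T0_def using Y0 C(1) by (simp add: add_nonneg_nonneg)
  moreover have "(2 / T) powr (1 / (2 * ln y)) * (1 + qprod (1 / (2 * ln y)) (primes_le (nat \<lfloor>y\<rfloor>))) ^ (2 * k) \<le> 1 / 2"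
    if T: "T \<ge> T0" and y: "2 \<le> y" "y \<le> ln T" and k: "2 \<le> k" "real k \<le> y / (ln y)\<^sup>2" for T y :: real and k :: nat
  proof -
    define s where "s = (\<Sum>p\<in>primes_le (nat \<lfloor>y\<rfloor>). 1 / real p)"
    define \<sigma> where "\<sigma> = 1 / (2 * ln y)"
    have T1: "T \<ge> 1" using T \<open>T0 \<ge> 1\<close> by linarith
    have "ln (2::real) \<le> ln y" using y by (subst ln_le_cancel_iff) auto
    moreover have ln2: "2 / 3 \<le> ln (2::real)" by (rule ln2_ge_two_thirds)
    ultimately have lny: "2 / 3 \<le> ln y" by linarith
    have s: "s \<le> 1 / 96 * ln y + C" using C(2)[of y] y by (simp add: s_def)
    have \<sigma>: "0 < \<sigma>" "\<sigma> \<le> 1" using lny by (auto simp: \<sigma>_def field_simps)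
    have "(2 / T) powr \<sigma> = 2 powr \<sigma> * exp (- \<sigma> * ln T)" using T1 by (simp add: powr_divide powr_def[of T] exp_minus field_simps)
    also have "\<dots> \<le> 2 * exp (- \<sigma> * ln T)" using \<sigma> powr_mono[of \<sigma> 1 "2::real"] by (intro mult_right_mono) auto
    finally have 1: "(2 / T) powr \<sigma> \<le> 2 * exp (- \<sigma> * ln T)" .
    have "(1 + qprod \<sigma> (primes_le (nat \<lfloor>y\<rfloor>))) ^ (2 * k) \<le> exp (1 + 12 * s) ^ (2 * k)"
      unfolding \<sigma>_def s_def using one_plus_qprod_le[OF y(1)] qprod_mono(1)[OF y(1) order_refl] by (intro power_mono) auto
    also have "\<dots> = exp (2 * real k * (1 + 12 * s))" by (simp add: exp_of_nat_mult[symmetric])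
    finally have 2: "(1 + qprod \<sigma> (primes_le (nat \<lfloor>y\<rfloor>))) ^ (2 * k) \<le> exp (2 * real k * (1 + 12 * s))" .
    have "(2 / T) powr \<sigma> * (1 + qprod \<sigma> (primes_le (nat \<lfloor>y\<rfloor>))) ^ (2 * k) \<le> 2 * exp (- \<sigma> * ln T) * exp (2 * real k * (1 + 12 * s))"
      using 1 2 qprod_mono(1)[OF y(1) order_refl] by (intro mult_mono) (auto simp: \<sigma>_def)
    also have "\<dots> = 2 * exp (2 * real k * (1 + 12 * s) - \<sigma> * ln T)" by (simp add: exp_add[symmetric])
    also have "\<dots> \<le> 2 * exp (- 2)"
    proof -
      have "2 * real k * (1 + 12 * s) - \<sigma> * ln T \<le> - 2"
      proof (cases "y \<ge> Y0")
        case True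
        then have "ln Y0 \<le> ln y" using Y0 y by (subst ln_le_cancel_iff) auto
        then have big: "12 + 96 * C \<le> ln y" by (simp add: lnY0)
        have "real k * (ln y)\<^sup>2 \<le> y" using k lny by (simp add: field_simps)
        then have "\<sigma> * (real k * (ln y)\<^sup>2) \<le> \<sigma> * ln T" using y \<sigma> by (intro mult_left_mono) auto
        moreover have "\<sigma> * (real k * (ln y)\<^sup>2) = real k * (ln y / 2)" using lny by (simp add: \<sigma>_def power2_eq_square)
        ultimately have "2 * real k * (1 + 12 * s) - \<sigma> * ln T \<le> real k * (2 + 24 * s - ln y / 2)"
          by (simp add: algebra_simps)
        also have "\<dots> \<le> real k * (- 1)" using s big by (intro mult_left_mono) auto
        also have "\<dots> \<le> -2" using k by simp
        finally show ?thesis .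
      next
        case False
        then have "ln y \<le> ln Y0" using Y0 y by (subst ln_le_cancel_iff) auto
        with s have s': "s \<le> 1 / 96 * ln Y0 + C" by simp
        have "(2 / 3) ^ 2 \<le> (ln y)\<^sup>2" using lny by (intro power_mono) auto
        then have "y / (ln y)\<^sup>2 \<le> y / (2 / 3) ^ 2" using y by (intro divide_left_mono) auto
        also have "\<dots> \<le> 3 * Y0" using False y by (simp add: power2_eq_square)
        finally have k': "real k \<le> 3 * Y0" using k by simp
        have "s \<ge> 0" unfolding s_def by (rule sum_nonneg) simp
        then have "2 * real k * (1 + 12 * s) \<le> 2 * (3 * Y0) * (1 + 12 * (1 / 96 * ln Y0 + C))"
          using k' s' by (intro mult_mono) auto
        moreover have "2 + 6 * Y0 * (1 + 12 * (1 / 96 * ln Y0 + C)) \<le> \<sigma> * ln T"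
        proof -
          have "ln T0 \<le> ln T" using T \<open>T0 \<ge> 1\<close> by (subst ln_le_cancel_iff) auto
          then have "2 * ln Y0 * (2 + 6 * Y0 * (1 + 12 * (1 / 96 * ln Y0 + C))) \<le> ln T" by (simp add: T0_def)
          moreover have "2 * ln y * (2 + 6 * Y0 * (1 + 12 * (1 / 96 * ln Y0 + C))) \<le> 2 * ln Y0 * (2 + 6 * Y0 * (1 + 12 * (1 / 96 * ln Y0 + C)))"
            using \<open>ln y \<le> ln Y0\<close> Y0 C(1) by (intro mult_right_mono) auto
          ultimately have "2 * ln y * (2 + 6 * Y0 * (1 + 12 * (1 / 96 * ln Y0 + C))) \<le> ln T" by linarith
          then show ?thesis using lny by (simp add: \<sigma>_def field_simps)
        qed
        ultimately show ?thesis by linarith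
      qed
      then show ?thesis by simp
    qed
    also have "\<dots> \<le> 1 / 2"
    proof -
      have "(4::real) \<le> exp 1 * exp 1" using exp_ge_add_one_self[of 1] mult_mono[of 2 "exp 1" 2 "exp (1::real)"] by simp
      then have "(4::real) \<le> exp 2" by (simp add: exp_add[symmetric])
      then show ?thesis by (simp add: exp_minus field_simps)
    qed
    finally show ?thesis by (simp add: \<sigma>_def)
  qed
  ultimately show ?thesis by blast
qed

section \<open>Mean squares of Dirichlet series\<close>

lemma integral_cis_le:
  assumes "c \<noteq> 0" "a \<le> b"
  shows "norm (integral {a..b} (\<lambda>t. cis (c * t))) \<le> 2 / \<bar>c\<bar>"
proof -
  have "((\<lambda>t. cis (c * t)) has_integral (cis (c * b) / (\<i> * c) - cis (c * a) / (\<i> * c))) {a..b}"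
  proof (rule fundamental_theorem_of_calculus)
    fix x assume "x \<in> {a..b}"
    have "((\<lambda>t. exp (\<i> * c * of_real t) / (\<i> * c)) has_vector_derivative exp (\<i> * c * of_real x)) (at x within {a..b})"
      using assms by (auto intro!: derivative_eq_intros has_vector_derivative_real_field)
    then show "((\<lambda>t. cis (c * t) / (\<i> * c)) has_vector_derivative cis (c * x)) (at x within {a..b})"
      by (simp add: cis_conv_exp mult_ac)
  qed (use assms in auto)
  then have "norm (integral {a..b} (\<lambda>t. cis (c * t))) = norm (cis (c * b) - cis (c * a)) / \<bar>c\<bar>"
    by (simp add: integral_unique diff_divide_distrib[symmetric] norm_divide norm_mult)
  also have "\<dots> \<le> 2 / \<bar>c\<bar>"
    using norm_triangle_ineq4[of "cis (c * b)" "cis (c * a)"] by (intro divide_right_mono) auto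
  finally show ?thesis .
qed

text \<open>For m < n, ln(m/n) \<le> m/n - 1 \<le> -1/n. The symmetric form 1/(mn) is chosen because
  it separates the two variables.\<close>

lemma abs_ln_diff_nat_ge:
  fixes m n :: nat
  assumes "m > 0" "n > 0" "m \<noteq> n"
  shows "1 / (real m * real n) \<le> \<bar>ln (real n) - ln (real m)\<bar>"
  using assms
proof (induction m n rule: linorder_wlog)
  case (le m n)
  have "ln (real m / real n) \<le> real m / real n - 1"
    using le by (intro ln_le_minus_one) auto
  also have "\<dots> = - ((real n - real m) * real m) / (real m * real n)"
    using le by (simp add: field_simps)
  also have "\<dots> \<le> - 1 / (real m * real n)"
  proof (rule divide_right_mono)
    have "1 \<le> real n - real m" "1 \<le> real m" using le by linarith+
    then have "1 * 1 \<le> (real n - real m) * real m" by (intro mult_mono) auto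
    then show "- ((real n - real m) * real m) \<le> -1" by simp
  qed simp
  finally show ?case using le by (simp add: ln_div)
next
  case (sym m n)
  then show ?case by (simp add: abs_minus_commute mult.commute)
qed

text \<open>Interpolates between the trivial bound T and the oscillation bound 2mn. The result is a
  function of m times the same function of n, so the off-diagonal double sum becomes a
  square.\<close>

lemma integral_cis_ln_le:
  fixes m n :: nat
  assumes "m > 0" "n > 0" "m \<noteq> n" "T > 0" "0 \<le> \<sigma>" "\<sigma> \<le> 1"
  shows "norm (integral {T..2 * T} (\<lambda>t. cis ((ln n - ln m) * t)))
           \<le> T * (2 / T) powr \<sigma> * (real m powr \<sigma> * real n powr \<sigma>)"
proof -
  let ?I = "norm (integral {T..2 * T} (\<lambda>t. cis ((ln n - ln m) * t)))"
  have c: "ln (real n) - ln (real m) \<noteq> 0" using assms by simp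
  have "?I \<le> 2 / \<bar>ln n - ln m\<bar>" using c assms by (intro integral_cis_le) auto
  also have "\<dots> \<le> 2 / (1 / (real m * real n))"
    using abs_ln_diff_nat_ge[OF assms(1-3)] assms by (intro divide_left_mono) auto
  finally have 1: "?I \<le> 2 * (real m * real n)" by simp
  have "?I \<le> integral {T..2 * T} (\<lambda>_. 1)"
    by (rule integral_norm_bound_integral) (auto intro!: integrable_continuous_interval continuous_intros)
  then have 2: "?I \<le> T" using assms by simp
  define x where "x = 2 * (real m * real n) / T"
  have x: "x > 0" using assms by (simp add: x_def)
  have "?I / T \<le> min 1 x" using 1 2 assms by (simp add: x_def field_simps)
  also have "\<dots> \<le> x powr \<sigma>"
  proof (cases "x \<ge> 1")
    case True
    then show ?thesis using assms by (simp add: ge_one_powr_ge_zero)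
  next
    case False
    then have "x powr 1 \<le> x powr \<sigma>" using assms x by (intro powr_mono') auto
    then show ?thesis using x False by simp
  qed
  also have "x powr \<sigma> = (2 / T) powr \<sigma> * (real m powr \<sigma> * real n powr \<sigma>)"
    using assms by (simp add: x_def powr_mult powr_divide)
  finally show ?thesis using assms by (simp add: field_simps)
qed

text \<open>Expanding the square, the terms with m = n give the main term and all others are bounded
  by \<open>integral_cis_ln_le\<close>; adding the nonnegative diagonal to the majorant completes it
  to a perfect square.\<close>

lemma mean_square_finite:
  fixes a :: "nat \<Rightarrow> complex"
  assumes "finite S" "S \<subseteq> {0<..}" "T > 0" "0 \<le> \<sigma>" "\<sigma> \<le> 1"
  shows "\<bar>integral {T..2 * T} (\<lambda>t. norm (\<Sum>n\<in>S. a n * cis (- t * ln n)) ^ 2)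
            - T * (\<Sum>n\<in>S. norm (a n) ^ 2)\<bar>
         \<le> T * (2 / T) powr \<sigma> * (\<Sum>n\<in>S. norm (a n) * real n powr \<sigma>) ^ 2"
proof -
  define J where "J m n = integral {T..2 * T} (\<lambda>t. cis ((ln (real n) - ln (real m)) * t))" for m n :: nat
  have exp: "complex_of_real (norm (\<Sum>n\<in>S. a n * cis (- t * ln n)) ^ 2) =
     (\<Sum>m\<in>S. \<Sum>n\<in>S. a m * cnj (a n) * cis ((ln n - ln m) * t))" for t
    unfolding complex_norm_square cnj_sum sum_product
  proof (intro sum.cong refl)
    fix m n
    have "cis (- t * ln (real m)) * cis (t * ln (real n)) = cis ((ln n - ln m) * t)"
      by (simp add: cis_mult algebra_simps)
    then show "a m * cis (- t * ln m) * cnj (a n * cis (- t * ln n)) = a m * cnj (a n) * cis ((ln n - ln m) * t)"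
      by (simp add: cis_cnj)
  qed
  have J: "((\<lambda>t. cis ((ln (real n) - ln (real m)) * t)) has_integral J m n) {T..2 * T}" for m n :: nat
    unfolding J_def by (intro integrable_integral integrable_continuous_interval continuous_intros)
  have "((\<lambda>t. complex_of_real (norm (\<Sum>n\<in>S. a n * cis (- t * ln n)) ^ 2)) has_integral
     (\<Sum>m\<in>S. \<Sum>n\<in>S. a m * cnj (a n) * J m n)) {T..2 * T}"
    unfolding exp using assms(1) by (intro has_integral_sum has_integral_mult_right J)
  moreover have "((\<lambda>t. complex_of_real (norm (\<Sum>n\<in>S. a n * cis (- t * ln n)) ^ 2)) has_integral
     complex_of_real (integral {T..2 * T} (\<lambda>t. norm (\<Sum>n\<in>S. a n * cis (- t * ln n)) ^ 2))) {T..2 * T}"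
    by (intro has_integral_of_real integrable_integral integrable_continuous_interval continuous_intros)
  ultimately have eq: "complex_of_real (integral {T..2 * T} (\<lambda>t. norm (\<Sum>n\<in>S. a n * cis (- t * ln n)) ^ 2)) =
      (\<Sum>m\<in>S. \<Sum>n\<in>S. a m * cnj (a n) * J m n)"
    by (rule has_integral_unique[rotated])
  have diag: "J n n = complex_of_real T" for n
    using assms by (simp add: J_def scaleR_conv_of_real)
  have "complex_of_real (T * (\<Sum>n\<in>S. norm (a n) ^ 2)) = (\<Sum>m\<in>S. \<Sum>n\<in>S. if n = m then a m * cnj (a n) * T else 0)"
    unfolding sum_distrib_left of_real_sum of_real_mult complex_norm_square
    using assms(1) by (intro sum.cong refl) simp
  then have "complex_of_real (integral {T..2 * T} (\<lambda>t. norm (\<Sum>n\<in>S. a n * cis (- t * ln n)) ^ 2) - T * (\<Sum>n\<in>S. norm (a n) ^ 2))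
      = (\<Sum>m\<in>S. \<Sum>n\<in>S. a m * cnj (a n) * J m n - (if n = m then a m * cnj (a n) * T else 0))"
    by (simp only: of_real_diff eq sum_subtractf)
  then have "\<bar>integral {T..2 * T} (\<lambda>t. norm (\<Sum>n\<in>S. a n * cis (- t * ln n)) ^ 2) - T * (\<Sum>n\<in>S. norm (a n) ^ 2)\<bar>
      = norm (\<Sum>m\<in>S. \<Sum>n\<in>S. a m * cnj (a n) * J m n - (if n = m then a m * cnj (a n) * T else 0))"
    by (simp only: norm_of_real[symmetric, where 'a = complex])
  also have "\<dots> \<le> (\<Sum>m\<in>S. \<Sum>n\<in>S. T * (2 / T) powr \<sigma> * ((norm (a m) * real m powr \<sigma>) * (norm (a n) * real n powr \<sigma>)))"
  proof (intro sum_norm_le)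
    fix m n assume mn: "m \<in> S" "n \<in> S"
    show "norm (a m * cnj (a n) * J m n - (if n = m then a m * cnj (a n) * T else 0))
       \<le> T * (2 / T) powr \<sigma> * ((norm (a m) * real m powr \<sigma>) * (norm (a n) * real n powr \<sigma>))"
    proof (cases "n = m")
      case True
      then show ?thesis using assms by (simp add: diag)
    next
      case False
      have "norm (J m n) \<le> T * (2 / T) powr \<sigma> * (real m powr \<sigma> * real n powr \<sigma>)"
        unfolding J_def using False mn assms by (intro integral_cis_ln_le) auto
      then have "norm (a m) * norm (a n) * norm (J m n)
         \<le> norm (a m) * norm (a n) * (T * (2 / T) powr \<sigma> * (real m powr \<sigma> * real n powr \<sigma>))"
        by (intro mult_left_mono) auto
      then show ?thesis using False by (simp add: norm_mult mult_ac)
    qed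
  qed
  also have "\<dots> = T * (2 / T) powr \<sigma> * (\<Sum>n\<in>S. norm (a n) * real n powr \<sigma>) ^ 2"
    unfolding power2_eq_square sum_product by (simp only: sum_distrib_left)
  finally show ?thesis .
qed

text \<open>The bound \<open>min 1 x \<le> x\<^sup>\<sigma>\<close> for the off-diagonal integrals spares any truncation
  of the series.\<close>

theorem mean_square_dirichlet_series:
  fixes a :: "nat \<Rightarrow> complex"
  assumes "T > 0" "0 \<le> \<sigma>" "\<sigma> \<le> 1"
  assumes sum\<sigma>: "((\<lambda>n. norm (a n) * real n powr \<sigma>) has_sum A) {0<..}"
  assumes sumsq: "((\<lambda>n. norm (a n) ^ 2) has_sum B) {0<..}"
  assumes F: "\<And>t. t \<in> {T..2 * T} \<Longrightarrow> ((\<lambda>n. a n * cis (- t * ln n)) has_sum F t) {0<..}"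
  shows "\<bar>integral {T..2 * T} (\<lambda>t. norm (F t) ^ 2) - T * B\<bar> \<le> T * (2 / T) powr \<sigma> * A ^ 2"
proof -
  let ?P = "\<lambda>S t. \<Sum>n\<in>S. a n * cis (- t * ln (real n))"
  let ?\<F> = "finite_subsets_at_top {0::nat<..}"
  \<comment> \<open>Since \<sigma> \<ge> 0, convergence at the shift \<sigma> gives absolute
    convergence without the shift, hence a Weierstrass majorant that is uniform in t.\<close>
  have abssum: "(\<lambda>n. norm (a n)) summable_on {0<..}"
  proof (rule summable_on_comparison_test)
    show "(\<lambda>n. norm (a n) * real n powr \<sigma>) summable_on {0<..}" using sum\<sigma> by (auto simp: summable_on_def)
    fix n :: nat assume "n \<in> {0<..}"
    then have "1 \<le> real n powr \<sigma>" using assms by (simp add: ge_one_powr_ge_zero)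
    then show "norm (a n) \<le> norm (a n) * real n powr \<sigma>" by (simp add: mult_le_cancel_left1)
  qed auto
  have "uniform_limit {T..2 * T} ?P (\<lambda>t. \<Sum>\<^sub>\<infinity>n\<in>{0<..}. a n * cis (- t * ln (real n))) ?\<F>"
    by (rule Weierstrass_m_test_general[OF _ abssum]) (simp add: norm_mult)
  also have "?this \<longleftrightarrow> uniform_limit {T..2 * T} ?P F ?\<F>"
    by (rule uniform_limit_cong') (use F in \<open>auto simp: infsumI\<close>)
  finally have lim: "uniform_limit {T..2 * T} ?P F ?\<F>" .
  \<comment> \<open>Boundedness of the limit is what makes the product of the uniform limits F and
    its conjugate a uniform limit again.\<close>
  have bdd: "bounded (F ` {T..2 * T})"
  proof (rule uniform_limit_bounded[OF lim])
    show "\<forall>\<^sub>F S in ?\<F>. bounded (?P S ` {T..2 * T})"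
      by (intro always_eventually allI compact_imp_bounded compact_continuous_image continuous_intros) auto
  qed auto
  have "uniform_limit {T..2 * T} (\<lambda>S t. ?P S t * cnj (?P S t)) (\<lambda>t. F t * cnj (F t)) ?\<F>"
    using bdd by (intro uniform_lim_mult lim bounded_linear.uniform_limit[OF bounded_linear_cnj])
       (auto simp: image_image bounded_iff)
  from bounded_linear.uniform_limit[OF bounded_linear_Re this]
  have lim2: "uniform_limit {T..2 * T} (\<lambda>S t. norm (?P S t) ^ 2) (\<lambda>t. norm (F t) ^ 2) ?\<F>"
    by (simp only: complex_norm_square[symmetric] Re_complex_of_real)
  obtain I J where IJ: "\<And>S. ((\<lambda>t. norm (?P S t) ^ 2) has_integral I S) {T..2 * T}"
     "((\<lambda>t. norm (F t) ^ 2) has_integral J) {T..2 * T}" "(I \<longlongrightarrow> J) ?\<F>"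
    by (rule uniform_limit_integral[OF lim2]) (auto intro!: continuous_intros)
  have "((\<lambda>S. \<bar>I S - T * (\<Sum>n\<in>S. norm (a n) ^ 2)\<bar>) \<longlongrightarrow> \<bar>J - T * B\<bar>) ?\<F>"
    using sumsq unfolding has_sum_def by (intro tendsto_intros IJ)
  moreover have "\<forall>\<^sub>F S in ?\<F>. \<bar>I S - T * (\<Sum>n\<in>S. norm (a n) ^ 2)\<bar> \<le> T * (2 / T) powr \<sigma> * A ^ 2"
  proof (rule eventually_finite_subsets_at_top_weakI)
    fix S :: "nat set" assume S: "finite S" "S \<subseteq> {0<..}"
    have "\<bar>I S - T * (\<Sum>n\<in>S. norm (a n) ^ 2)\<bar>
         \<le> T * (2 / T) powr \<sigma> * (\<Sum>n\<in>S. norm (a n) * real n powr \<sigma>) ^ 2"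
      using mean_square_finite[OF S assms(1-3), of a] IJ(1)[of S] by (simp add: integral_unique)
    also have "\<dots> \<le> T * (2 / T) powr \<sigma> * A ^ 2"
    proof (intro mult_left_mono power_mono)
      show "(\<Sum>n\<in>S. norm (a n) * real n powr \<sigma>) \<le> A"
        by (rule finite_sum_le_has_sum[OF sum\<sigma>]) (use S in auto)
    qed (use assms in \<open>auto intro!: sum_nonneg\<close>)
    finally show "\<bar>I S - T * (\<Sum>n\<in>S. norm (a n) ^ 2)\<bar> \<le> T * (2 / T) powr \<sigma> * A ^ 2" .
  qed
  ultimately have "\<bar>J - T * B\<bar> \<le> T * (2 / T) powr \<sigma> * A ^ 2"
    by (rule tendsto_upperbound) auto
  then show ?thesis using IJ(2) by (simp add: integral_unique)
qed

section \<open>Dirichlet convolution and Euler products\<close>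

lemma has_sum_product_complex:
  fixes f :: "'a \<Rightarrow> complex" and g :: "'b \<Rightarrow> complex"
  assumes "(f has_sum x) A" "(g has_sum y) B"
  shows "((\<lambda>(a, b). f a * g b) has_sum (x * y)) (A \<times> B)"
proof (rule has_sum_SigmaI)
  show "((\<lambda>b. case (a, b) of (a, b) \<Rightarrow> f a * g b) has_sum (f a * y)) B" for a
    using has_sum_cmult_right[OF assms(2), of "f a"] by simp
  show "((\<lambda>a. f a * y) has_sum x * y) A"
    using has_sum_cmult_left[OF assms(1)] .
  have "(\<lambda>a. norm (f a)) summable_on A" "(\<lambda>b. norm (g b)) summable_on B"
    using assms by (auto simp: summable_on_iff_abs_summable_on_complex[symmetric] summable_on_def)
  then have "(\<lambda>x. norm ((\<lambda>(a, b). f a * g b) x)) summable_on A \<times> B"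
    by (subst Infinite_Sum.abs_summable_on_Sigma_iff)
       (simp add: norm_mult infsum_cmult_right' abs_mult infsum_nonneg summable_on_cmult_right summable_on_cmult_left)
  then show "(\<lambda>(a, b). f a * g b) summable_on A \<times> B" by (rule abs_summable_summable)
qed

text \<open>The value type is left open: coefficients are real, while the series twisted by f(n)
  n^(-it) are complex.\<close>

definition dconv :: "(nat \<Rightarrow> 'a :: comm_semiring_1) \<Rightarrow> (nat \<Rightarrow> 'a) \<Rightarrow> nat \<Rightarrow> 'a" where
  "dconv a b n = (\<Sum>d | d dvd n. a d * b (n div d))"

lemma has_sum_dconv:
  fixes a b :: "nat \<Rightarrow> complex"
  assumes "(a has_sum x) {0<..}" "(b has_sum y) {0<..}"
  shows "(dconv a b has_sum (x * y)) {0<..}"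
proof -
  have "((\<lambda>(d, e). a d * b e) has_sum (x * y)) ({0<..} \<times> {0<..})"
    by (rule has_sum_product_complex) fact+
  also have "?this \<longleftrightarrow> ((\<lambda>(n, d). a d * b (n div d)) has_sum (x * y)) (SIGMA n:{0<..}. {d. d dvd n})"
    by (rule has_sum_reindex_bij_witness[where i = "\<lambda>(n, d). (d, n div d)" and j = "\<lambda>(d, e). (d * e, d)"])
       (auto elim!: dvdE)
  finally have *: "((\<lambda>(n, d). a d * b (n div d)) has_sum (x * y)) (SIGMA n:{0<..}. {d. d dvd n})" .
  show ?thesis
    unfolding dconv_def
  proof (rule has_sum_SigmaD[OF *])
    fix n :: nat assume "n \<in> {0<..}"
    then show "((\<lambda>d. case (n, d) of (n, d) \<Rightarrow> a d * b (n div d)) has_sum (\<Sum>d | d dvd n. a d * b (n div d))) {d. d dvd n}"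
      by (auto intro!: has_sum_finite)
  qed
qed

lemma completely_multiplicative_one: "completely_multiplicative g \<Longrightarrow> g (Suc 0) = 1"
  by (simp add: completely_multiplicative_def)

lemma completely_multiplicative_mult: "completely_multiplicative g \<Longrightarrow> m > 0 \<Longrightarrow> n > 0 \<Longrightarrow> g (m * n) = g m * g n"
  by (simp add: completely_multiplicative_def)

lemma completely_multiplicative_power: "completely_multiplicative g \<Longrightarrow> n > 0 \<Longrightarrow> g (n ^ k) = g n ^ k"
  by (induction k) (auto simp: completely_multiplicative_one completely_multiplicative_mult)

text \<open>g(d) g(n/d) = g(n) for every divisor d, so a completely multiplicative twist factors out
  of the convolution, and powers need only be taken of the untwisted coefficients.\<close>

lemma dconv_completely_multiplicative:
  fixes a b :: "nat \<Rightarrow> real"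
  assumes "completely_multiplicative g" "n > 0"
  shows "dconv (\<lambda>n. of_real (a n) * g n) (\<lambda>n. of_real (b n) * g n) n = of_real (dconv a b n) * g n"
proof -
  have "dconv (\<lambda>n. of_real (a n) * g n) (\<lambda>n. of_real (b n) * g n) n =
      (\<Sum>d | d dvd n. of_real (a d * b (n div d)) * g n)"
    unfolding dconv_def
  proof (rule sum.cong)
    fix d assume "d \<in> {d. d dvd n}"
    then obtain e where e: "n = d * e" by auto
    then have "g n = g d * g e" using assms by (auto intro!: completely_multiplicative_mult)
    then show "of_real (a d) * g d * (of_real (b (n div d)) * g (n div d)) = of_real (a d * b (n div d)) * g n"
      using e assms by auto
  qed simp
  then show ?thesis by (simp add: dconv_def sum_distrib_right)
qed

primrec dpow :: "(nat \<Rightarrow> real) \<Rightarrow> nat \<Rightarrow> nat \<Rightarrow> real" where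
  "dpow a 0 = (\<lambda>n. if n = 1 then 1 else 0)"
| "dpow a (Suc k) = dconv a (dpow a k)"

lemma has_sum_dpow:
  assumes "completely_multiplicative g" "((\<lambda>n. of_real (a n) * g n) has_sum x) {0<..}"
  shows "((\<lambda>n. of_real (dpow a k n) * g n) has_sum x ^ k) {0<..}"
proof (induction k)
  case 0
  have "((\<lambda>n. of_real (dpow a 0 n) * g n) has_sum 1) {1}"
    using assms by (auto intro!: has_sum_finiteI simp: completely_multiplicative_one)
  also have "?this \<longleftrightarrow> ((\<lambda>n. of_real (dpow a 0 n) * g n) has_sum 1) {0<..}"
    by (rule has_sum_cong_neutral) auto
  finally show ?case by simp
next
  case (Suc k)
  have "(dconv (\<lambda>n. of_real (a n) * g n) (\<lambda>n. of_real (dpow a k n) * g n) has_sum x * x ^ k) {0<..}"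
    by (intro has_sum_dconv assms Suc)
  also have "?this \<longleftrightarrow> ((\<lambda>n. of_real (dpow a (Suc k) n) * g n) has_sum x ^ Suc k) {0<..}"
    unfolding power_Suc by (rule has_sum_cong) (use assms in \<open>auto simp: dconv_completely_multiplicative\<close>)
  finally show ?case .
qed

lemma dpow_nonneg: "(\<And>n. a n \<ge> 0) \<Longrightarrow> dpow a k n \<ge> 0"
  by (induction k arbitrary: n) (auto simp: dconv_def intro!: sum_nonneg)

lemma dpow_one: "dpow a k (Suc 0) = a (Suc 0) ^ k"
  by (induction k) (auto simp: dconv_def)

definition smooth :: "nat set \<Rightarrow> nat set" where
  "smooth S = {n. n > 0 \<and> prime_factors n \<subseteq> S}"

lemma smooth_pos: "n \<in> smooth S \<Longrightarrow> n > 0"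
  by (simp add: smooth_def)

lemma one_in_smooth [simp]: "Suc 0 \<in> smooth S"
  by (simp add: smooth_def)

text \<open>Induction on S: each number composed of primes from p and S is uniquely p^j m with m
  composed of primes from S, so adding p multiplies the sum by a geometric series.\<close>

theorem has_sum_smooth:
  assumes "finite S" "\<And>p. p \<in> S \<Longrightarrow> prime p" "completely_multiplicative g" "\<And>p. p \<in> S \<Longrightarrow> norm (g p) < 1"
  shows "(g has_sum (\<Prod>p\<in>S. inverse (1 - g p))) (smooth S)"
  using assms(1,2,4)
proof (induction S rule: finite_induct)
  case empty
  have "smooth {} = {1}" by (auto simp: smooth_def prime_factorization_empty_iff)
  then show ?case using assms(3) has_sum_finite[of "{1}" g] by (simp add: completely_multiplicative_one)
next
  case (insert p S)
  have p: "prime p" "norm (g p) < 1" using insert by auto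
  then have p0: "p > 0" by (simp add: prime_gt_0_nat)
  have "((\<lambda>j. g p ^ j) has_sum (1 / (1 - g p))) UNIV"
    using p by (intro norm_summable_imp_has_sum geometric_sums) (auto simp: norm_power summable_geometric)
  then have "((\<lambda>(j, n). g p ^ j * g n) has_sum (inverse (1 - g p) * (\<Prod>p\<in>S. inverse (1 - g p)))) (UNIV \<times> smooth S)"
    using insert by (intro has_sum_product_complex) (auto simp: inverse_eq_divide)
  also have "?this \<longleftrightarrow> (g has_sum (\<Prod>p\<in>insert p S. inverse (1 - g p))) (smooth (insert p S))"
    unfolding prod.insert[OF insert(1,2)]
  proof (rule has_sum_reindex_bij_witness
      [where j = "\<lambda>(j, n). p ^ j * n" and i = "\<lambda>n. (multiplicity p n, n div p ^ multiplicity p n)"])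
    fix x :: "nat \<times> nat" assume x: "x \<in> UNIV \<times> smooth S"
    obtain j n where jn: "x = (j, n)" by (cases x)
    with x have n: "n > 0" "prime_factors n \<subseteq> S" by (auto simp: smooth_def)
    then have "\<not> p dvd n" using insert.hyps p by (auto simp: prime_factors_dvd)
    then have m: "multiplicity p (p ^ j * n) = j"
      using p0 by (intro multiplicity_decomposeI[OF refl]) auto
    show "(multiplicity p (case x of (j, n) \<Rightarrow> p ^ j * n),
         (case x of (j, n) \<Rightarrow> p ^ j * n) div p ^ multiplicity p (case x of (j, n) \<Rightarrow> p ^ j * n)) = x"
      using m p0 by (simp add: jn)
    have "prime_factors (p ^ j * n) \<subseteq> insert p S"
    proof
      fix q assume "q \<in> prime_factors (p ^ j * n)"
      then have q: "prime q" "q dvd p ^ j \<or> q dvd n"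
        by (simp_all add: in_prime_factors_iff) (use prime_dvd_mult_iff in blast)
      from q(2) show "q \<in> insert p S"
      proof
        assume "q dvd p ^ j"
        then have "q dvd p" using q by (auto dest: prime_dvd_power)
        then show ?thesis using q p primes_dvd_imp_eq by auto
      next
        assume "q dvd n"
        then show ?thesis using q n by (auto simp: prime_factors_dvd)
      qed
    qed
    then show "(case x of (j, n) \<Rightarrow> p ^ j * n) \<in> smooth (insert p S)"
      using n p0 by (simp add: jn smooth_def)
    show "g (case x of (j, n) \<Rightarrow> p ^ j * n) = (case x of (j, n) \<Rightarrow> g p ^ j * g n)"
      using n p0 assms(3) by (simp add: jn completely_multiplicative_mult completely_multiplicative_power)
  next
    fix n assume "n \<in> smooth (insert p S)"
    then have n: "n > 0" "prime_factors n \<subseteq> insert p S" by (auto simp: smooth_def)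
    define k where "k = n div p ^ multiplicity p n"
    have k: "n = p ^ multiplicity p n * k" by (simp add: k_def multiplicity_dvd)
    have "\<not> p dvd k" unfolding k_def using n p by (intro multiplicity_decompose) auto
    moreover have "k > 0" using n(1) k by (metis gr0I mult_0_right less_irrefl)
    moreover have "prime_factors k \<subseteq> prime_factors n"
      using n(1) by (intro dvd_prime_factors) (simp, metis dvd_triv_right k)
    ultimately have "k > 0" "prime_factors k \<subseteq> S" using n(2) by (auto simp: in_prime_factors_iff)
    then show "(multiplicity p n, n div p ^ multiplicity p n) \<in> UNIV \<times> smooth S"
      by (simp add: k_def smooth_def)
    show "(case (multiplicity p n, n div p ^ multiplicity p n) of (j, n) \<Rightarrow> p ^ j * n) = n"
      by (simp add: multiplicity_dvd)
  qed (rule refl)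
  finally show ?case .
qed

section \<open>Completely multiplicative weights and coefficients of powers\<close>

definition cmult :: "(nat \<Rightarrow> real) \<Rightarrow> nat \<Rightarrow> real" where
  "cmult \<rho> n = prod_mset (image_mset \<rho> (prime_factorization n))"

lemma cmult_one [simp]: "cmult \<rho> (Suc 0) = 1"
  by (simp add: cmult_def)

lemma cmult_mult: "m > 0 \<Longrightarrow> n > 0 \<Longrightarrow> cmult \<rho> (m * n) = cmult \<rho> m * cmult \<rho> n"
  by (simp add: cmult_def prime_factorization_mult)

lemma cmult_prime: "prime p \<Longrightarrow> cmult \<rho> p = \<rho> p"
  by (simp add: cmult_def prime_factorization_prime)

lemma cmult_nonneg:
  assumes "\<And>p. \<rho> p \<ge> 0"
  shows "cmult \<rho> n \<ge> 0"
proof -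
  have "prod_mset (image_mset \<rho> M) \<ge> 0" for M
    by (induction M) (auto simp: assms)
  then show ?thesis by (simp add: cmult_def)
qed

lemma cmult_eq_0:
  assumes "p \<in> prime_factors n" "\<rho> p = 0"
  shows "cmult \<rho> n = 0"
proof -
  have "0 \<in># image_mset \<rho> (prime_factorization n)" using assms by (force simp: image_iff)
  then show ?thesis by (simp add: cmult_def)
qed

text \<open>With a constant value a at the primes, \<open>cmult\<close> is a^Omega(n). Every divisor
  of pn is a divisor of n or p times one, so each further prime factor multiplies the divisor sum by
  at most 1 + a.\<close>

lemma sum_divisors_cmult_const_le:
  assumes "n > 0" "a \<ge> 0"
  shows "(\<Sum>d | d dvd n. cmult (\<lambda>_. a) d) \<le> cmult (\<lambda>_. 1 + a) n"
  using assms(1)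
proof (induction n rule: prime_divisors_induct)
  case (unit x)
  then show ?case by simp
next
  case (factor p n)
  then have n: "n > 0" "p > 0" by auto
  have "(\<Sum>d | d dvd p * n. cmult (\<lambda>_. a) d) \<le> (\<Sum>d\<in>{d. d dvd n} \<union> (\<lambda>d. p * d) ` {d. d dvd n}. cmult (\<lambda>_. a) d)"
  proof (rule sum_mono2)
    show "{d. d dvd p * n} \<subseteq> {d. d dvd n} \<union> (\<lambda>d. p * d) ` {d. d dvd n}"
    proof
      fix d assume "d \<in> {d. d dvd p * n}"
      then have d: "d dvd p * n" by simp
      show "d \<in> {d. d dvd n} \<union> (\<lambda>d. p * d) ` {d. d dvd n}"
      proof (cases "p dvd d")
        case True
        then obtain e where e: "d = p * e" ..
        with d n have "e dvd n" by simp
        with e show ?thesis by blast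
      next
        case False
        then have "coprime d p" using factor.hyps(1) prime_imp_coprime coprime_commute by blast
        with d have "d dvd n" by (simp add: coprime_dvd_mult_right_iff)
        then show ?thesis by simp
      qed
    qed
  qed (use n assms(2) in \<open>auto intro!: cmult_nonneg\<close>)
  also have "\<dots> \<le> (\<Sum>d | d dvd n. cmult (\<lambda>_. a) d) + (\<Sum>d\<in>(\<lambda>d. p * d) ` {d. d dvd n}. cmult (\<lambda>_. a) d)"
    using n assms(2) by (subst sum_Un) (auto intro!: sum_nonneg cmult_nonneg)
  also have "(\<Sum>d\<in>(\<lambda>d. p * d) ` {d. d dvd n}. cmult (\<lambda>_. a) d) = (\<Sum>d | d dvd n. a * cmult (\<lambda>_. a) d)"
  proof (subst sum.reindex)
    show "inj_on (\<lambda>d. p * d) {d. d dvd n}" using n by (auto simp: inj_on_def)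
    show "(\<Sum>d | d dvd n. (cmult (\<lambda>_. a) \<circ> (\<lambda>d. p * d)) d) = (\<Sum>d | d dvd n. a * cmult (\<lambda>_. a) d)"
    proof (rule sum.cong)
      fix d assume "d \<in> {d. d dvd n}"
      then have "d > 0" using n(1) dvd_pos_nat by blast
      then show "(cmult (\<lambda>_. a) \<circ> (\<lambda>d. p * d)) d = a * cmult (\<lambda>_. a) d"
        using n factor.hyps by (simp add: cmult_mult cmult_prime)
    qed simp
  qed
  also have "(\<Sum>d | d dvd n. cmult (\<lambda>_. a) d) + \<dots> = (1 + a) * (\<Sum>d | d dvd n. cmult (\<lambda>_. a) d)"
    by (simp add: sum_distrib_left distrib_right sum.distrib)
  also have "\<dots> \<le> (1 + a) * cmult (\<lambda>_. 1 + a) n"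
    using factor n assms(2) by (intro mult_left_mono) auto
  also have "\<dots> = cmult (\<lambda>_. 1 + a) (p * n)"
    using n factor.hyps by (simp add: cmult_mult cmult_prime)
  finally show ?case .
qed simp

text \<open>Coefficients of \<open>r + \<Prod>\<^bsub>p \<in> S\<^esub> (1 - p\<^sup>-\<^sup>s)\<^sup>-\<^sup>1\<close>. The twists by \<open>f(n) n\<^bsup>-it\<^esup>\<close>, \<open>n\<^sup>\<sigma>\<close> or test weights are
  kept outside, so that one family of nonnegative coefficients serves all of them.\<close>

definition lcoef :: "real \<Rightarrow> nat set \<Rightarrow> nat \<Rightarrow> real" where
  "lcoef r S n = (if n \<in> smooth S then 1 / real n else 0) + (if n = 1 then r else 0)"

lemma lcoef_nonneg: "r \<ge> 0 \<Longrightarrow> lcoef r S n \<ge> 0"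
  by (simp add: lcoef_def)

lemma has_sum_lcoef:
  assumes "finite S" "\<And>p. p \<in> S \<Longrightarrow> prime p" "completely_multiplicative g"
    "\<And>p. p \<in> S \<Longrightarrow> norm (g p) < real p"
  shows "((\<lambda>n. of_real (lcoef r S n) * g n) has_sum (of_real r + (\<Prod>p\<in>S. inverse (1 - g p / of_nat p)))) {0<..}"
proof -
  have "completely_multiplicative (\<lambda>n. g n / of_nat n)"
    using assms(3) by (auto simp: completely_multiplicative_def)
  then have "((\<lambda>n. g n / of_nat n) has_sum (\<Prod>p\<in>S. inverse (1 - g p / of_nat p))) (smooth S)"
    using assms by (intro has_sum_smooth) (auto simp: norm_divide divide_less_eq_1 dest: prime_gt_0_nat)
  also have "?this \<longleftrightarrow> ((\<lambda>n. if n \<in> smooth S then g n / of_nat n else 0) has_sum (\<Prod>p\<in>S. inverse (1 - g p / of_nat p))) {0<..}"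
    by (rule has_sum_cong_neutral) (auto simp: smooth_pos)
  finally have 1: "((\<lambda>n. if n \<in> smooth S then g n / of_nat n else 0) has_sum (\<Prod>p\<in>S. inverse (1 - g p / of_nat p))) {0<..}" .
  have "((\<lambda>n. if n = 1 then of_real r else (0::complex)) has_sum of_real r) {1::nat}"
    by (auto intro!: has_sum_finiteI)
  also have "?this \<longleftrightarrow> ((\<lambda>n. if n = 1 then of_real r else (0::complex)) has_sum of_real r) {0::nat<..}"
    by (rule has_sum_cong_neutral) auto
  finally have 2: "((\<lambda>n. if n = 1 then of_real r else (0::complex)) has_sum of_real r) {0::nat<..}" .
  have "(if n = 1 then of_real r else 0) + (if n \<in> smooth S then g n / of_nat n else 0)
          = of_real (lcoef r S n) * g n" for n
    using completely_multiplicative_one[OF assms(3)] by (simp add: lcoef_def distrib_right)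
  with has_sum_add[OF 2 1] show ?thesis by simp
qed

text \<open>For n composed of primes in S the left side is d_k(n)/n, with d_k the k-fold divisor
  function; d_k(n) \<le> k^Omega(n) follows by induction on k from
  \<open>sum_divisors_cmult_const_le\<close>.\<close>

lemma dpow_lcoef_le:
  assumes "n > 0"
  shows "dpow (lcoef 0 S) k n \<le> cmult (\<lambda>_. real k) n / real n"
  using assms
proof (induction k arbitrary: n)
  case 0
  then show ?case by (auto intro!: divide_nonneg_nonneg cmult_nonneg)
next
  case (Suc k)
  have "dpow (lcoef 0 S) (Suc k) n = (\<Sum>d | d dvd n. lcoef 0 S d * dpow (lcoef 0 S) k (n div d))"
    by (simp add: dconv_def)
  also have "\<dots> \<le> (\<Sum>d | d dvd n. cmult (\<lambda>_. real k) (n div d) / real n)"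
  proof (rule sum_mono)
    fix d assume "d \<in> {d. d dvd n}"
    then obtain e where e: "n = d * e" by auto
    with Suc.prems have de: "d > 0" "e > 0" by auto
    have "lcoef 0 S d * dpow (lcoef 0 S) k e \<le> (1 / real d) * (cmult (\<lambda>_. real k) e / real e)"
      using Suc.IH[of e] de
      by (intro mult_mono dpow_nonneg lcoef_nonneg) (auto simp: lcoef_def[of _ _ d])
    then show "lcoef 0 S d * dpow (lcoef 0 S) k (n div d) \<le> cmult (\<lambda>_. real k) (n div d) / real n"
      using e de by simp
  qed
  also have "\<dots> = (\<Sum>d | d dvd n. cmult (\<lambda>_. real k) d / real n)"
  proof (rule sum.reindex_bij_witness[of _ "\<lambda>d. n div d" "\<lambda>d. n div d"])
    fix d assume "d \<in> {d. d dvd n}"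
    then obtain e where e: "n = d * e" by auto
    with Suc.prems have "d > 0" "e > 0" by auto
    then show "n div (n div d) = d" "n div d \<in> {d. d dvd n}" "n div (n div d) = d" "n div d \<in> {d. d dvd n}"
      by (simp_all add: e)
  qed simp
  also have "\<dots> = (\<Sum>d | d dvd n. cmult (\<lambda>_. real k) d) / real n"
    by (simp add: sum_divide_distrib)
  also have "\<dots> \<le> cmult (\<lambda>_. 1 + real k) n / real n"
    using Suc.prems by (intro divide_right_mono sum_divisors_cmult_const_le) auto
  finally show ?case by simp
qed

text \<open>Evaluates the pairing of the coefficients with any real completely multiplicative
  weight; the complex theorem is applied to the embedded weight and read back in the reals.\<close>

lemma has_sum_dpow_lcoef:
  fixes h :: "nat \<Rightarrow> real"
  assumes S: "finite S" "\<And>p. p \<in> S \<Longrightarrow> prime p"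
    and h: "h 1 = 1" "\<And>m n. m > 0 \<Longrightarrow> n > 0 \<Longrightarrow> h (m * n) = h m * h n"
    and lt: "\<And>p. p \<in> S \<Longrightarrow> \<bar>h p\<bar> < real p"
  shows "((\<lambda>n. dpow (lcoef r S) k n * h n) has_sum (r + (\<Prod>p\<in>S. inverse (1 - h p / real p))) ^ k) {0<..}"
proof -
  have cm: "completely_multiplicative (\<lambda>n. of_real (h n))"
    using h by (simp add: completely_multiplicative_def)
  have "((\<lambda>n. of_real (lcoef r S n) * of_real (h n)) has_sum
          (of_real r + (\<Prod>p\<in>S. inverse (1 - complex_of_real (h p) / of_nat p)))) {0<..}"
    using S lt by (intro has_sum_lcoef cm) auto
  from has_sum_dpow[OF cm this, of k]
  have "((\<lambda>n. complex_of_real (dpow (lcoef r S) k n * h n)) has_sum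
          complex_of_real ((r + (\<Prod>p\<in>S. inverse (1 - h p / real p))) ^ k)) {0<..}"
    by simp
  then show ?thesis by (simp only: has_sum_of_real_iff)
qed

lemma euler_factor_conv_cis:
  assumes "p > 0"
  shows "(f p * cis (- t * ln (real p))) / of_nat p = f p * of_nat p powr (- (1 + \<i> * of_real t))"
proof -
  have "of_nat p powr (- (1 + \<i> * of_real t)) = exp (- (1 + \<i> * of_real t) * of_real (ln (real p)))"
    using assms by (simp add: powr_def Ln_of_nat)
  also have "\<dots> = exp (- of_real (ln (real p))) * exp (\<i> * of_real (- t * ln (real p)))"
    by (simp add: algebra_simps exp_add[symmetric] exp_diff[symmetric])
  also have "exp (- complex_of_real (ln (real p))) = 1 / of_nat p"
    using assms by (simp add: exp_minus exp_of_real inverse_eq_divide)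
  finally show ?thesis by (simp add: cis_conv_exp)
qed

text \<open>The k-th power is a Dirichlet series with coefficients c(n) f(n). As f(n) has modulus 1,
  their absolute values are c(n), so the diagonal B and the error bound do not depend on f.\<close>

theorem mean_value_euler_product:
  fixes f :: "nat \<Rightarrow> complex"
  assumes S: "finite S" "\<And>p. p \<in> S \<Longrightarrow> prime p"
    and f: "completely_multiplicative f" "\<And>n. n > 0 \<Longrightarrow> norm (f n) = 1"
    and "r \<ge> 0" "T > 0" "0 \<le> \<sigma>" "\<sigma> < 1"
  obtains B where "((\<lambda>n. dpow (lcoef r S) k n ^ 2) has_sum B) {0<..}"
    "\<bar>integral {T..2 * T} (\<lambda>t. norm (of_real r + (\<Prod>p\<in>S. inverse (1 - f p * of_nat p powr (- (1 + \<i> * of_real t))))) ^ (2 * k)) - T * B\<bar>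
       \<le> T * (2 / T) powr \<sigma> * (r + (\<Prod>p\<in>S. inverse (1 - real p powr \<sigma> / real p))) ^ (2 * k)"
proof -
  define c where "c = dpow (lcoef r S) k"
  have c: "c n \<ge> 0" for n
    using assms by (auto simp: c_def intro!: dpow_nonneg lcoef_nonneg)
  define A where "A = (r + (\<Prod>p\<in>S. inverse (1 - real p powr \<sigma> / real p))) ^ k"
  have p_less: "real p powr \<sigma> < real p" if "p \<in> S" for p
    using powr_less_mono[of \<sigma> 1 "real p"] assms(8) prime_gt_1_nat[OF S(2)[OF that]] by simp
  have A: "((\<lambda>n. c n * real n powr \<sigma>) has_sum A) {0<..}"
    unfolding A_def c_def using p_less by (intro has_sum_dpow_lcoef S) (auto simp: powr_mult)
  have cn: "c n \<le> c n * real n powr \<sigma>" if "n > 0" for n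
    using that assms(7) c[of n] by (simp add: mult_le_cancel_left1 ge_one_powr_ge_zero)
  \<comment> \<open>Each c(n) is at most the whole sum A, hence c(n)^2 \<le> A c(n)
    n^\<sigma>.\<close>
  have "(\<lambda>n. c n ^ 2) summable_on {0<..}"
  proof (rule summable_on_comparison_test)
    show "(\<lambda>n. A * (c n * real n powr \<sigma>)) summable_on {0<..}"
      using A by (intro summable_on_cmult_right) (auto simp: summable_on_def)
    fix n :: nat assume n: "n \<in> {0<..}"
    have "(\<Sum>m\<in>{n}. c m * real m powr \<sigma>) \<le> A"
      by (rule finite_sum_le_has_sum[OF A]) (use n c in auto)
    with cn[of n] n have "c n \<le> A" by simp
    then show "c n ^ 2 \<le> A * (c n * real n powr \<sigma>)"
      unfolding power2_eq_square using cn[of n] c[of n] n by (intro mult_mono) auto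
  qed auto
  then obtain B where B: "((\<lambda>n. c n ^ 2) has_sum B) {0<..}" by (auto simp: summable_on_def)
  define a where "a n = of_real (c n) * f n" for n
  have na: "norm (a n) = c n" if "n \<in> {0<..}" for n
    using that c[of n] f(2)[of n] by (simp add: a_def norm_mult)
  define F where "F t = (of_real r + (\<Prod>p\<in>S. inverse (1 - f p * of_nat p powr (- (1 + \<i> * of_real t))))) ^ k" for t
  have "\<bar>integral {T..2 * T} (\<lambda>t. norm (F t) ^ 2) - T * B\<bar> \<le> T * (2 / T) powr \<sigma> * A ^ 2"
  proof (rule mean_square_dirichlet_series[where a = a])
    show "((\<lambda>n. norm (a n) * real n powr \<sigma>) has_sum A) {0<..}"
      using A by (rule has_sum_cong[THEN iffD2, rotated]) (simp add: na)
    show "((\<lambda>n. norm (a n) ^ 2) has_sum B) {0<..}"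
      using B by (rule has_sum_cong[THEN iffD2, rotated]) (simp add: na)
    fix t :: real
    let ?g = "\<lambda>n. f n * cis (- t * ln (real n))"
    have cm: "completely_multiplicative ?g"
      using f(1) by (auto simp: completely_multiplicative_def ln_mult cis_mult algebra_simps)
    have "((\<lambda>n. of_real (lcoef r S n) * ?g n) has_sum (of_real r + (\<Prod>p\<in>S. inverse (1 - ?g p / of_nat p)))) {0<..}"
    proof (rule has_sum_lcoef[OF S cm])
      fix p assume "p \<in> S"
      then have "1 < p" using S(2) prime_gt_1_nat by blast
      then show "norm (?g p) < real p" using f(2)[of p] by (simp add: norm_mult)
    qed
    from has_sum_dpow[OF cm this, of k]
    have *: "((\<lambda>n. of_real (c n) * ?g n) has_sum (of_real r + (\<Prod>p\<in>S. inverse (1 - ?g p / of_nat p))) ^ k) {0<..}"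
      by (simp only: c_def)
    have "(\<Prod>p\<in>S. inverse (1 - ?g p / of_nat p)) = (\<Prod>p\<in>S. inverse (1 - f p * of_nat p powr (- (1 + \<i> * of_real t))))"
      by (intro prod.cong refl) (simp only: euler_factor_conv_cis[OF prime_gt_0_nat[OF S(2)]])
    with * show "((\<lambda>n. a n * cis (- t * ln (real n))) has_sum F t) {0<..}"
      by (simp only: F_def a_def mult.assoc)
  qed (use assms in auto)
  moreover have "norm (F t) ^ 2 = norm (of_real r + (\<Prod>p\<in>S. inverse (1 - f p * of_nat p powr (- (1 + \<i> * of_real t))))) ^ (2 * k)" for t
    by (simp add: F_def norm_power power_mult[symmetric] mult.commute)
  moreover have "A ^ 2 = (r + (\<Prod>p\<in>S. inverse (1 - real p powr \<sigma> / real p))) ^ (2 * k)"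
    by (simp add: A_def power_mult[symmetric] mult.commute)
  ultimately show ?thesis using that B unfolding c_def by simp
qed

text \<open>The coefficient at n = 1 alone gives (1 + r)^(2k). This lower bound for the diagonal
  later absorbs the off-diagonal error.\<close>

lemma sum_dpow_lcoef_sq_ge_power:
  assumes "((\<lambda>n. dpow (lcoef r S) k n ^ 2) has_sum B) {0<..}" "r \<ge> 0"
  shows "r ^ (2 * k) \<le> B"
proof -
  have "r ^ k \<le> (1 + r) ^ k" using assms by (intro power_mono) auto
  then have "(r ^ k) ^ 2 \<le> ((1 + r) ^ k) ^ 2" using assms by (intro power_mono) auto
  also have "\<dots> = (\<Sum>n\<in>{1}. dpow (lcoef r S) k n ^ 2)"
    by (simp add: dpow_one) (simp add: lcoef_def)
  also have "\<dots> \<le> B" by (rule finite_sum_le_has_sum[OF assms(1)]) auto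
  finally show ?thesis by (simp add: power_mult[symmetric] mult.commute)
qed

text \<open>Duality: the coefficients are tested against the completely multiplicative weights
  with \<open>w(p) = \<rho>(p)\<close>, for which the pairing is again an Euler product.\<close>

lemma sum_dpow_lcoef_sq_ge:
  fixes \<rho> :: "nat \<Rightarrow> real"
  assumes B: "((\<lambda>n. dpow (lcoef r S) k n ^ 2) has_sum B) {0<..}" and "r \<ge> 0"
    and S: "finite S" "\<And>p. p \<in> S \<Longrightarrow> prime p" and S': "S' \<subseteq> S"
    and \<rho>: "\<And>p. p \<in> S' \<Longrightarrow> 0 \<le> \<rho> p \<and> \<rho> p < 1"
  shows "(r + (\<Prod>p\<in>S'. inverse (1 - \<rho> p / real p))) ^ (2 * k) \<le> B * (\<Prod>p\<in>S'. inverse (1 - \<rho> p ^ 2))"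
proof -
  define c where "c = dpow (lcoef r S) k"
  have c: "c n \<ge> 0" for n using assms by (auto simp: c_def intro!: dpow_nonneg lcoef_nonneg)
  \<comment> \<open>Weight 0 at the remaining primes makes their Euler factors 1, so both products
    run over S' only and w is supported on \<open>smooth S'\<close>.\<close>
  define \<rho>' where "\<rho>' p = (if p \<in> S' then \<rho> p else 0)" for p
  define w where "w = cmult \<rho>'"
  have w: "w n \<ge> 0" for n unfolding w_def using \<rho> by (intro cmult_nonneg) (simp add: \<rho>'_def)
  have wp: "w p = \<rho>' p" if "p \<in> S" for p using S(2)[OF that] by (simp add: w_def cmult_prime)
  define A where "A = (r + (\<Prod>p\<in>S'. inverse (1 - \<rho> p / real p))) ^ k"
  define W where "W = (\<Prod>p\<in>S'. inverse (1 - \<rho> p ^ 2))"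
  have finS': "finite S'" using S S' finite_subset by blast
  have "((\<lambda>n. c n * w n) has_sum (r + (\<Prod>p\<in>S. inverse (1 - w p / real p))) ^ k) {0<..}"
    unfolding c_def
  proof (rule has_sum_dpow_lcoef)
    fix p assume p: "p \<in> S"
    then have "1 < real p" using S(2) prime_gt_1_nat by auto
    moreover have "\<bar>w p\<bar> \<le> 1" using \<rho>[of p] p by (auto simp: wp \<rho>'_def)
    ultimately show "\<bar>w p\<bar> < real p" by linarith
  qed (use S in \<open>auto simp: w_def cmult_mult\<close>)
  also have "(\<Prod>p\<in>S. inverse (1 - w p / real p)) = (\<Prod>p\<in>S'. inverse (1 - \<rho> p / real p))"
    by (rule prod.mono_neutral_cong_right) (use S S' wp in \<open>auto simp: \<rho>'_def\<close>)
  finally have cw: "((\<lambda>n. c n * w n) has_sum A) {0<..}" by (simp add: A_def)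
  have "((\<lambda>n. complex_of_real (w n ^ 2)) has_sum (\<Prod>p\<in>S'. inverse (1 - complex_of_real (w p ^ 2)))) (smooth S')"
  proof (rule has_sum_smooth)
    show "completely_multiplicative (\<lambda>n. complex_of_real ((w n)\<^sup>2))"
      by (simp add: completely_multiplicative_def w_def cmult_mult power_mult_distrib)
    fix p assume p: "p \<in> S'"
    then show "norm (complex_of_real (w p ^ 2)) < 1" "prime p"
      using S S' \<rho>[of p] by (auto simp: wp \<rho>'_def norm_power subset_iff power_less_one_iff abs_square_less_1)
  qed (use finS' in auto)
  also have "(\<Prod>p\<in>S'. inverse (1 - complex_of_real (w p ^ 2))) = complex_of_real W"
    unfolding W_def of_real_prod by (intro prod.cong refl) (use S' wp in \<open>auto simp: \<rho>'_def subset_iff\<close>)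
  finally have "((\<lambda>n. w n ^ 2) has_sum W) (smooth S')" by (simp only: has_sum_of_real_iff)
  also have "?this \<longleftrightarrow> ((\<lambda>n. w n ^ 2) has_sum W) {0<..}"
  proof (rule has_sum_cong_neutral)
    fix n assume "n \<in> {0<..} - smooth S'"
    then obtain p where "p \<in> prime_factors n" "p \<notin> S'" by (auto simp: smooth_def)
    then show "w n ^ 2 = 0" unfolding w_def by (subst cmult_eq_0[of p]) (auto simp: \<rho>'_def)
  qed (auto dest: smooth_pos)
  finally have w2: "((\<lambda>n. w n ^ 2) has_sum W) {0<..}" .
  have nonneg: "0 \<le> B" "0 \<le> W" "0 \<le> A"
    using has_sum_nonneg[OF B] has_sum_nonneg[OF w2] has_sum_nonneg[OF cw] c w by auto
  \<comment> \<open>Cauchy-Schwarz on finite sets, uniformly, and hence for the full sum.\<close>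
  have "A \<le> sqrt B * sqrt W"
  proof (rule has_sum_le_finite_sums[OF cw])
    fix E :: "nat set" assume E: "finite E" "E \<subseteq> {0<..}"
    have "(\<Sum>n\<in>E. c n * w n) = (\<Sum>n\<in>E. \<bar>c n\<bar> * \<bar>w n\<bar>)" using c w by simp
    also have "\<dots> \<le> L2_set c E * L2_set w E" by (rule L2_set_mult_ineq)
    also have "\<dots> \<le> sqrt B * sqrt W"
      unfolding L2_set_def
      by (intro mult_mono real_sqrt_le_mono finite_sum_le_has_sum[OF B[folded c_def]] finite_sum_le_has_sum[OF w2])
         (use E nonneg in \<open>auto intro!: sum_nonneg\<close>)
    finally show "(\<Sum>n\<in>E. c n * w n) \<le> sqrt B * sqrt W" .
  qed
  then have "A ^ 2 \<le> (sqrt B * sqrt W) ^ 2" using nonneg by (intro power_mono) auto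
  then show ?thesis using nonneg by (simp add: A_def W_def power_mult_distrib power_mult[symmetric] mult.commute)
qed

text \<open>Since \<open>d\<^sub>k(n) \<le> k\<^sup>\<Omega>\<^sup>(\<^sup>n\<^sup>)\<close>, the sum of squares is bounded by a pairing with completely
  multiplicative weights.\<close>

lemma sum_dpow_lcoef_sq_le:
  assumes B: "((\<lambda>n. dpow (lcoef 0 S) k n ^ 2) has_sum B) {0<..}"
    and S: "finite S" "\<And>p. p \<in> S \<Longrightarrow> prime p \<and> k < p"
  shows "B \<le> (\<Prod>p\<in>S. inverse (1 - real k / real p ^ 2)) ^ k"
proof -
  define h where "h n = cmult (\<lambda>_. real k) n / real n" for n
  have hp: "h p = real k / real p" if "p \<in> S" for p
    using S(2)[OF that] by (simp add: h_def cmult_prime)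
  have "((\<lambda>n. dpow (lcoef 0 S) k n * h n) has_sum (0 + (\<Prod>p\<in>S. inverse (1 - h p / real p))) ^ k) {0<..}"
  proof (rule has_sum_dpow_lcoef)
    fix p assume p: "p \<in> S"
    then have "real k / real p < 1" "1 < real p" using S(2)[OF p] prime_gt_1_nat[of p] by auto
    moreover have "\<bar>real k / real p\<bar> = real k / real p" by simp
    ultimately have "\<bar>real k / real p\<bar> < real p" by linarith
    then show "\<bar>h p\<bar> < real p" using p by (simp only: hp)
  qed (use S in \<open>auto simp: h_def cmult_mult\<close>)
  also have "(\<Prod>p\<in>S. inverse (1 - h p / real p)) = (\<Prod>p\<in>S. inverse (1 - real k / real p ^ 2))"
    by (intro prod.cong refl) (simp add: hp power2_eq_square)
  finally have ch: "((\<lambda>n. dpow (lcoef 0 S) k n * h n) has_sum (\<Prod>p\<in>S. inverse (1 - real k / real p ^ 2)) ^ k) {0<..}"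
    by simp
  show ?thesis
  proof (rule has_sum_mono[OF B ch])
    fix n :: nat assume "n \<in> {0<..}"
    then have "dpow (lcoef 0 S) k n \<le> h n" unfolding h_def by (intro dpow_lcoef_le) auto
    moreover have "dpow (lcoef 0 S) k n \<ge> 0" by (intro dpow_nonneg lcoef_nonneg) simp
    ultimately show "dpow (lcoef 0 S) k n ^ 2 \<le> dpow (lcoef 0 S) k n * h n"
      by (simp add: power2_eq_square mult_left_mono)
  qed
qed

section \<open>Moments of the truncated Euler product\<close>

definition eprod :: "(nat \<Rightarrow> complex) \<Rightarrow> nat set \<Rightarrow> real \<Rightarrow> complex" where
  "eprod f S t = (\<Prod>p\<in>S. inverse (1 - f p * of_nat p powr (- (1 + \<i> * of_real t))))"

lemma euler_L_conv_eprod: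
  "euler_L f (1 + \<i> * of_real t) y = eprod f (primes_le (nat \<lfloor>y\<rfloor>)) t"
  by (simp add: euler_L_def eprod_def primes_real_le_conv)

lemma norm_euler_term:
  assumes "norm (f p) = 1" "p > 0"
  shows "norm (f p * of_nat p powr (- (1 + \<i> * of_real t))) = 1 / real p"
  using euler_factor_conv_cis[OF assms(2), of f t, symmetric] assms by (simp add: norm_mult norm_divide)

context
  fixes f :: "nat \<Rightarrow> complex" and S :: "nat set"
  assumes S: "finite S" "\<And>p. p \<in> S \<Longrightarrow> prime p" and f: "\<And>n. n > 0 \<Longrightarrow> norm (f n) = 1"
begin

lemma norm_euler_term_less_1:
  assumes "p \<in> S"
  shows "norm (f p * of_nat p powr (- (1 + \<i> * of_real t))) = 1 / real p" "1 / real p < 1"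
  using norm_euler_term[where f = f and p = p and t = t] f prime_gt_1_nat[OF S(2)[OF assms]] by auto

lemma norm_eprod_le: "norm (eprod f S t) \<le> rprod S"
  unfolding eprod_def rprod_def prod_norm[symmetric]
proof (rule prod_mono, rule conjI)
  fix p assume p: "p \<in> S"
  let ?z = "f p * of_nat p powr (- (1 + \<i> * of_real t))"
  have "1 - 1 / real p \<le> norm (1 - ?z)"
    using norm_triangle_ineq2[of 1 ?z] norm_euler_term_less_1(1)[OF p, where t = t] by simp
  then show "norm (inverse (1 - ?z)) \<le> inverse (1 - 1 / real p)"
    unfolding norm_inverse using norm_euler_term_less_1(2)[OF p] by (intro le_imp_inverse_le) auto
qed simp

lemma continuous_on_eprod: "continuous_on A (eprod f S)"
proof -
  have eq: "eprod f S = (\<lambda>t. \<Prod>p\<in>S. inverse (1 - f p * cis (- t * ln (real p)) / of_nat p))"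
    unfolding eprod_def by (intro ext prod.cong refl) (simp only: euler_factor_conv_cis[OF prime_gt_0_nat[OF S(2)]])
  have "1 - f p * cis (- t * ln (real p)) / of_nat p \<noteq> 0" if "p \<in> S" for p t
    using norm_euler_term_less_1(1)[OF that, of t] norm_euler_term_less_1(2)[OF that]
    unfolding euler_factor_conv_cis[OF prime_gt_0_nat[OF S(2)[OF that]], symmetric] by auto
  then show ?thesis unfolding eq
    using prime_gt_0_nat[OF S(2)] by (intro continuous_intros) auto
qed

end

text \<open>Convexity of x^n at the points 1 and x with weights a/(a+b) and b/(a+b). It is applied
  with a = R, b = R_k and x = |M|.\<close>

lemma two_term_power_le:
  fixes a b x :: real
  assumes "a > 0" "b > 0" "even n"
  shows "(a + b * x) ^ n \<le> (a + b) ^ n * (a / (a + b) + b / (a + b) * x ^ n)"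
proof -
  have "convex_on UNIV (\<lambda>x::real. x ^ n)" by (rule convex_power_even) fact
  from convex_onD[OF this, of "b / (a + b)" 1 x] assms
  have "((1 - b / (a + b)) * 1 + b / (a + b) * x) ^ n \<le> (1 - b / (a + b)) * 1 ^ n + b / (a + b) * x ^ n"
    by simp
  moreover have "1 - b / (a + b) = a / (a + b)" using assms by (simp add: field_simps)
  ultimately have "(a / (a + b) + b / (a + b) * x) ^ n \<le> a / (a + b) + b / (a + b) * x ^ n" by simp
  then have "(a + b) ^ n * (a / (a + b) + b / (a + b) * x) ^ n \<le> (a + b) ^ n * (a / (a + b) + b / (a + b) * x ^ n)"
    using assms by (intro mult_left_mono) auto
  also have "(a + b) ^ n * (a / (a + b) + b / (a + b) * x) ^ n = (a + b * x) ^ n"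
  proof -
    have "a + b \<noteq> 0" using assms by simp
    then have "(a + b) * (a / (a + b) + b / (a + b) * x) = a + b * x"
      unfolding distrib_left by simp
    then show ?thesis by (simp only: power_mult_distrib[symmetric])
  qed
  finally show ?thesis .
qed

text \<open>The cubic Taylor remainder is nonpositive for s \<ge> 0.\<close>

lemma exp_minus_le_quadratic:
  fixes s :: real
  assumes "s \<ge> 0"
  shows "exp (- s) \<le> 1 - s + s\<^sup>2 / 2"
proof -
  have "\<exists>t>-s. t < 0 \<and> exp (- s) = (\<Sum>m<3. (-s) ^ m / fact m) + exp t / fact 3 * (-s) ^ 3" if "s > 0"
    using Maclaurin_minus[of "-s" 3 "\<lambda>_. exp" exp] that by (auto intro!: derivative_eq_intros)
  then obtain t where "exp (- s) = 1 - s + s\<^sup>2 / 2 + exp t / 6 * (-s) ^ 3 \<or> s = 0"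
    using assms by (cases "s = 0") (auto simp: eval_nat_numeral fact_numeral)
  moreover have "exp t / 6 * (-s) ^ 3 \<le> 0" using assms by (simp add: mult_nonneg_nonpos)
  ultimately show ?thesis by auto
qed

lemma prime_if_in_primes_le: "p \<in> primes_le n \<Longrightarrow> prime p"
  by (simp add: primes_le_def)

lemma euler_R_ge_1: "euler_R y \<ge> 1"
  unfolding euler_R_conv_rprod by (rule rprod_ge_1) (rule prime_if_in_primes_le)

section \<open>Upper and lower bounds for the moment\<close>

definition moment :: "real \<Rightarrow> real \<Rightarrow> (nat \<Rightarrow> complex) \<Rightarrow> nat \<Rightarrow> real" where
  "moment T y f k = 1 / T * integral {T..2 * T}
     (\<lambda>t. norm (euler_L f (1 + \<i> * of_real t) y + of_real (euler_R y)) ^ (2 * k))"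

context
  fixes T y :: real and f :: "nat \<Rightarrow> complex" and k :: nat
  assumes T: "T > 0" and y: "y \<ge> 2" and k: "k \<ge> 2"
    and f: "completely_multiplicative f" "\<And>n. n > 0 \<Longrightarrow> norm (f n) = 1"
    and small: "(2 / T) powr (1 / (2 * ln y)) * (1 + qprod (1 / (2 * ln y)) (primes_le (nat \<lfloor>y\<rfloor>))) ^ (2 * k) \<le> 1 / 2"
begin

lemmas R_ge_1 = euler_R_ge_1[of y]

lemma sigma: "0 \<le> 1 / (2 * ln y)" "1 / (2 * ln y) < 1"
proof -
  have "ln 2 \<le> ln y" using y by (subst ln_le_cancel_iff) auto
  with ln2_ge_two_thirds have "2 / 3 \<le> ln y" by linarith
  then show "0 \<le> 1 / (2 * ln y)" "1 / (2 * ln y) < 1" by (auto simp: field_simps)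
qed

text \<open>Pointwise |L| \<le> R. This bound serves the range of bounded y.\<close>

lemma moment_le: "moment T y f k \<le> (2 * euler_R y) ^ (2 * k)"
proof -
  have "integral {T..2 * T} (\<lambda>t. norm (eprod f (primes_le (nat \<lfloor>y\<rfloor>)) t + of_real (euler_R y)) ^ (2 * k))
       \<le> integral {T..2 * T} (\<lambda>_. (2 * euler_R y) ^ (2 * k))"
  proof (rule integral_le)
    fix t
    have "norm (eprod f (primes_le (nat \<lfloor>y\<rfloor>)) t + of_real (euler_R y)) \<le> 2 * euler_R y"
      using norm_triangle_ineq[of "eprod f (primes_le (nat \<lfloor>y\<rfloor>)) t" "of_real (euler_R y)"] R_ge_1
        norm_eprod_le[of "primes_le (nat \<lfloor>y\<rfloor>)" f t, OF finite_primes_le prime_if_in_primes_le[where n = "nat \<lfloor>y\<rfloor>"] f(2), folded euler_R_conv_rprod] by simp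
    then show "norm (eprod f (primes_le (nat \<lfloor>y\<rfloor>)) t + of_real (euler_R y)) ^ (2 * k) \<le> (2 * euler_R y) ^ (2 * k)"
      by (intro power_mono) auto
  next
    show "(\<lambda>_. (2 * euler_R y) ^ (2 * k)) integrable_on {T..2 * T}" by (rule integrable_const_ivl)
  qed (intro integrable_continuous_interval continuous_intros continuous_on_eprod finite_primes_le prime_if_in_primes_le f(2))
  also have "\<dots> = T * (2 * euler_R y) ^ (2 * k)" using T by simp
  finally show ?thesis unfolding moment_def euler_L_conv_eprod using T by (simp add: field_simps)
qed

text \<open>By \<open>small\<close> the off-diagonal error is at most T R^(2k)/2, and R^(2k) \<le>
  B, so half of the diagonal survives.\<close>

lemma moment_ge_coeffs:
  obtains B where "((\<lambda>n. dpow (lcoef (euler_R y) (primes_le (nat \<lfloor>y\<rfloor>))) k n ^ 2) has_sum B) {0<..}" "B / 2 \<le> moment T y f k"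
proof -
  let ?S = "primes_le (nat \<lfloor>y\<rfloor>)" let ?\<sigma> = "1 / (2 * ln y)" let ?R = "euler_R y"
  obtain B where B: "((\<lambda>n. dpow (lcoef ?R ?S) k n ^ 2) has_sum B) {0<..}"
    "\<bar>integral {T..2 * T} (\<lambda>t. norm (of_real ?R + eprod f ?S t) ^ (2 * k)) - T * B\<bar>
       \<le> T * (2 / T) powr ?\<sigma> * (?R + qprod ?\<sigma> ?S) ^ (2 * k)"
    by (rule mean_value_euler_product[OF finite_primes_le prime_if_in_primes_le[where n = "nat \<lfloor>y\<rfloor>"] f _ T sigma, where r = ?R and k = k,
          folded eprod_def qprod_def]) (use R_ge_1 in auto)
  have q: "0 \<le> qprod ?\<sigma> ?S" using y by (intro qprod_mono) auto
  \<comment> \<open>R \<ge> 1 lets R be pulled out, leaving exactly the quantity bounded in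
    \<open>small\<close>.\<close>
  have "?R + qprod ?\<sigma> ?S \<le> ?R * (1 + qprod ?\<sigma> ?S)"
    using R_ge_1 q mult_right_mono[of 1 ?R "qprod ?\<sigma> ?S"] by (simp add: distrib_left)
  then have "(2 / T) powr ?\<sigma> * (?R + qprod ?\<sigma> ?S) ^ (2 * k) \<le> (2 / T) powr ?\<sigma> * (?R * (1 + qprod ?\<sigma> ?S)) ^ (2 * k)"
    using R_ge_1 q by (intro mult_left_mono power_mono) auto
  also have "\<dots> = ?R ^ (2 * k) * ((2 / T) powr ?\<sigma> * (1 + qprod ?\<sigma> ?S) ^ (2 * k))" by (simp add: power_mult_distrib)
  also have "\<dots> \<le> ?R ^ (2 * k) * (1 / 2)" using small R_ge_1 by (intro mult_left_mono) auto
  also have "\<dots> \<le> B / 2" using sum_dpow_lcoef_sq_ge_power[OF B(1)] R_ge_1 by simp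
  finally have "T * ((2 / T) powr ?\<sigma> * (?R + qprod ?\<sigma> ?S) ^ (2 * k)) \<le> T * (B / 2)"
    using T by (intro mult_left_mono) auto
  with B(2) have "T * (B / 2) \<le> integral {T..2 * T} (\<lambda>t. norm (of_real ?R + eprod f ?S t) ^ (2 * k))"
    by (simp add: mult.assoc)
  then have "B / 2 \<le> moment T y f k"
    unfolding moment_def euler_L_conv_eprod using T by (simp add: field_simps add.commute)
  with B(1) that show ?thesis by blast
qed

lemma moment_ge_crude: "euler_R y ^ (2 * k) / 2 \<le> moment T y f k"
proof -
  obtain B where B: "((\<lambda>n. dpow (lcoef (euler_R y) (primes_le (nat \<lfloor>y\<rfloor>))) k n ^ 2) has_sum B) {0<..}" "B / 2 \<le> moment T y f k"
    by (rule moment_ge_coeffs)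
  then show ?thesis using sum_dpow_lcoef_sq_ge_power[OF B(1)] R_ge_1 by simp
qed

context
  assumes ky: "real k \<le> y"
begin

text \<open>Duality with the weights 1 - p/(2k): \<open>resonator_value_ge\<close> bounds the
  pairing from below and \<open>resonator_norm_le\<close> bounds the squared norm of the
  weights.\<close>

lemma moment_ge_fine:
  "((euler_R y + rprod (primes_le k)) * exp (- 2 * reson_const / ln (real k))) ^ (2 * k)
     * exp (- reson_const * (real k / ln (real k))) / 2 \<le> moment T y f k"
proof -
  let ?R = "euler_R y" let ?Rk = "rprod (primes_le k)" let ?e = "exp (- 2 * reson_const / ln (real k))"
  define W where "W = (\<Prod>p\<in>primes_le k. inverse (1 - (1 - real p / (2 * real k)) ^ 2))"
  define V where "V = (\<Prod>p\<in>primes_le k. inverse (1 - (1 - real p / (2 * real k)) / real p))"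
  obtain B where B: "((\<lambda>n. dpow (lcoef ?R (primes_le (nat \<lfloor>y\<rfloor>))) k n ^ 2) has_sum B) {0<..}" "B / 2 \<le> moment T y f k"
    by (rule moment_ge_coeffs)
  have "(?R + V) ^ (2 * k) \<le> B * W"
    unfolding V_def W_def
  proof (rule sum_dpow_lcoef_sq_ge[OF B(1) _ finite_primes_le prime_if_in_primes_le primes_le_subset[OF k ky]])
    fix p assume "p \<in> primes_le k"
    then have "0 < real p" "real p \<le> real k" by (auto simp: primes_le_def prime_gt_0_nat)
    then show "0 \<le> 1 - real p / (2 * real k) \<and> 1 - real p / (2 * real k) < 1" by simp
  qed (use R_ge_1 in auto)
  also have "\<dots> \<le> B * exp (reson_const * (real k / ln (real k)))"
    using resonator_norm_le[OF k] has_sum_nonneg[OF B(1)] unfolding W_def by (intro mult_left_mono) auto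
  finally have 1: "(?R + V) ^ (2 * k) \<le> B * exp (reson_const * (real k / ln (real k)))" .
  have Rk: "?Rk \<ge> 1" by (rule rprod_ge_1) (simp add: primes_le_def)
  \<comment> \<open>The loss incurred by R_k is imposed on R as well, so that it becomes a common
    factor of R + R_k.\<close>
  have "?e \<le> 1" using reson_const_pos k by (simp add: divide_nonneg_nonneg)
  then have "?R * ?e \<le> ?R * 1" using R_ge_1 by (intro mult_left_mono) auto
  then have "(?R + ?Rk) * ?e \<le> ?R + V"
    using resonator_value_ge[OF k] unfolding V_def[symmetric] by (simp add: distrib_right)
  then have "((?R + ?Rk) * ?e) ^ (2 * k) \<le> (?R + V) ^ (2 * k)"
    using R_ge_1 Rk by (intro power_mono) auto
  with 1 have "((?R + ?Rk) * ?e) ^ (2 * k) \<le> B * exp (reson_const * (real k / ln (real k)))" by linarith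
  then have "((?R + ?Rk) * ?e) ^ (2 * k) * exp (- reson_const * (real k / ln (real k))) \<le>
       B * exp (reson_const * (real k / ln (real k))) * exp (- reson_const * (real k / ln (real k)))"
    by (intro mult_right_mono) auto
  also have "\<dots> = B" by (simp add: mult.assoc exp_add[symmetric])
  finally show ?thesis using B(2) by simp
qed

text \<open>The primes up to k are bounded trivially by R_k; \<open>two_term_power_le\<close> then
  reduces the integrand to |M|^(2k), whose mean is the diagonal plus a small error.\<close>

lemma moment_le_fine:
  "moment T y f k \<le> (euler_R y + rprod (primes_le k)) ^ (2 * k) * (2 * exp (6 * ln 4 * (real k / ln (real k))))"
proof -
  let ?S = "primes_le (nat \<lfloor>y\<rfloor>)" let ?D = "?S - primes_le k" let ?\<sigma> = "1 / (2 * ln y)"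
  let ?R = "euler_R y" let ?Rk = "rprod (primes_le k)" let ?X = "exp (6 * ln 4 * (real k / ln (real k)))"
  define I where "I = integral {T..2 * T} (\<lambda>t. norm (eprod f ?D t) ^ (2 * k))"
  have Rk: "?Rk \<ge> 1" by (rule rprod_ge_1) (simp add: primes_le_def)
  have D: "finite ?D" "\<And>p. p \<in> ?D \<Longrightarrow> prime p" by (auto simp: primes_le_def)
  have pk: "\<And>p. p \<in> primes_le k \<Longrightarrow> prime p" by (simp add: primes_le_def)
  \<comment> \<open>With r = 0 the mean value theorem concerns M alone, whose coefficients live on
    primes p > k.\<close>
  obtain B where B: "((\<lambda>n. dpow (lcoef 0 ?D) k n ^ 2) has_sum B) {0<..}"
    "\<bar>integral {T..2 * T} (\<lambda>t. norm (of_real 0 + eprod f ?D t) ^ (2 * k)) - T * B\<bar>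
       \<le> T * (2 / T) powr ?\<sigma> * (0 + qprod ?\<sigma> ?D) ^ (2 * k)"
    by (rule mean_value_euler_product[OF D f _ T sigma, where r = 0 and k = k,
          folded eprod_def qprod_def]) auto
  have "B \<le> (\<Prod>p\<in>?D. inverse (1 - real k / real p ^ 2)) ^ k"
    using sum_dpow_lcoef_sq_le[OF B(1)] primes_between[OF k ky] by auto
  also have "\<dots> \<le> ?X" by (rule prod_inverse_square_between_le[OF k ky])
  finally have BX: "B \<le> ?X" .
  have "0 \<le> qprod ?\<sigma> ?D" "qprod ?\<sigma> ?D \<le> qprod ?\<sigma> ?S" using y by (auto intro!: qprod_mono)
  then have "(2 / T) powr ?\<sigma> * qprod ?\<sigma> ?D ^ (2 * k) \<le> (2 / T) powr ?\<sigma> * (1 + qprod ?\<sigma> ?S) ^ (2 * k)"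
    by (intro mult_left_mono power_mono) auto
  also note small
  finally have "T * ((2 / T) powr ?\<sigma> * qprod ?\<sigma> ?D ^ (2 * k)) \<le> T * (1 / 2)"
    using T by (intro mult_left_mono) auto
  with B(2) have "I \<le> T * B + T * (1 / 2)" by (simp add: I_def mult.assoc)
  \<comment> \<open>The off-diagonal contribution T/2 is absorbed because ?X \<ge> 1.\<close>
  also have "\<dots> \<le> T * ?X + T * ?X"
  proof (intro add_mono mult_left_mono BX)
    have "1 \<le> ?X" using k by simp
    then show "1 / 2 \<le> ?X" by linarith
  qed (use T in auto)
  finally have I: "I \<le> T * (2 * ?X)" by simp
  define a where "a = ?R / (?R + ?Rk)"
  define b where "b = ?Rk / (?R + ?Rk)"
  have ab: "0 \<le> a" "0 \<le> b" "a + b = 1" using R_ge_1 Rk by (auto simp: a_def b_def add_divide_distrib[symmetric])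
  have int1: "(\<lambda>t. norm (eprod f ?S t + of_real ?R) ^ (2 * k)) integrable_on {T..2 * T}"
    by (intro integrable_continuous_interval continuous_intros continuous_on_eprod finite_primes_le prime_if_in_primes_le f(2))
  have int2: "(\<lambda>t. norm (eprod f ?D t) ^ (2 * k)) integrable_on {T..2 * T}"
    by (intro integrable_continuous_interval continuous_intros continuous_on_eprod D f(2))
  have "((\<lambda>t. norm (eprod f ?D t) ^ (2 * k)) has_integral I) {T..2 * T}"
    unfolding I_def using int2 by (rule integrable_integral)
  moreover have "((\<lambda>_. a) has_integral T * a) {T..2 * T}" using has_integral_const_real[of a T "2 * T"] T by simp
  ultimately have has: "((\<lambda>t. (?R + ?Rk) ^ (2 * k) * (a + b * norm (eprod f ?D t) ^ (2 * k))) has_integral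
     (?R + ?Rk) ^ (2 * k) * (T * a + b * I)) {T..2 * T}"
    by (intro has_integral_mult_right has_integral_add)
  have "integral {T..2 * T} (\<lambda>t. norm (eprod f ?S t + of_real ?R) ^ (2 * k))
      \<le> (?R + ?Rk) ^ (2 * k) * (T * a + b * I)"
  proof (rule has_integral_le[OF integrable_integral[OF int1] has])
    fix t
    have "eprod f ?S t = eprod f ?D t * eprod f (primes_le k) t"
      unfolding eprod_def by (rule prod.subset_diff) (use primes_le_subset[OF k ky] in auto)
    then have "norm (eprod f ?S t) \<le> norm (eprod f ?D t) * ?Rk"
      using norm_eprod_le[of "primes_le k" f t, OF finite_primes_le pk f(2)]
      by (simp add: norm_mult mult_left_mono)
    then have "norm (eprod f ?S t + of_real ?R) \<le> ?R + ?Rk * norm (eprod f ?D t)"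
      using norm_triangle_ineq[of "eprod f ?S t" "of_real ?R"] R_ge_1 by (simp add: mult.commute)
    then have "norm (eprod f ?S t + of_real ?R) ^ (2 * k) \<le> (?R + ?Rk * norm (eprod f ?D t)) ^ (2 * k)"
      by (intro power_mono) auto
    also have "\<dots> \<le> (?R + ?Rk) ^ (2 * k) * (a + b * norm (eprod f ?D t) ^ (2 * k))"
      unfolding a_def b_def using R_ge_1 Rk by (intro two_term_power_le) auto
    finally show "norm (eprod f ?S t + of_real ?R) ^ (2 * k) \<le> \<dots>" .
  qed
  also have "\<dots> \<le> (?R + ?Rk) ^ (2 * k) * (T * a * (2 * ?X) + b * (T * (2 * ?X)))"
  proof (intro mult_left_mono add_mono I)
    have "1 \<le> ?X" using k by simp
    then have "1 \<le> 2 * ?X" by linarith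
    then have "T * a * 1 \<le> T * a * (2 * ?X)" using T ab by (intro mult_left_mono) auto
    then show "T * a \<le> T * a * (2 * ?X)" by simp
  qed (use ab R_ge_1 Rk in auto)
  also have "T * a * (2 * ?X) + b * (T * (2 * ?X)) = (a + b) * (T * (2 * ?X))" by (simp add: algebra_simps)
  finally show ?thesis unfolding moment_def euler_L_conv_eprod using T ab by (simp add: field_simps)
qed

text \<open>With \<rho> = R_k/R and h = (1 + \<rho>)/2 one has R + R_k = 2Rh, and \<rho> is close to
  exp(-s). Thus 2k ln h is -ks up to the stated errors: h \<ge> sqrt \<rho> from below, and the
  quadratic bound for exp(-s) from above.\<close>

lemma log_moment_bounds:
  defines "s \<equiv> \<Sum>p\<in>primes_le (nat \<lfloor>y\<rfloor>) - primes_le k. 1 / real p"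
    and "l \<equiv> ln (real k)" and "L \<equiv> ln (moment T y f k / (2 * euler_R y) ^ (2 * k))"
  shows "- real k * s - 6 * ln 4 / l - 5 * reson_const * real k / l - ln 2 \<le> L"
    and "L \<le> - real k * s + real k * s\<^sup>2 / 2 + 6 * ln 4 * real k / l + ln 2"
proof -
  let ?R = "euler_R y" let ?Rk = "rprod (primes_le k)"
  define \<rho> where "\<rho> = (\<Prod>p\<in>primes_le (nat \<lfloor>y\<rfloor>) - primes_le k. 1 - 1 / real p)"
  define h where "h = (1 + \<rho>) / 2"
  have l: "l > 0" using k by (simp add: l_def)
  have M: "(2 * ?R) ^ (2 * k) > 0" using R_ge_1 by simp
  have J: "moment T y f k > 0" using moment_ge_crude R_ge_1 by (smt (verit) half_gt_zero_iff zero_less_power)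
  have \<rho>1: "exp (- s - 6 * ln 4 / (real k * l)) \<le> \<rho>" "\<rho> \<le> exp (- s)"
    unfolding \<rho>_def s_def l_def by (rule prod_between_ge[OF k ky] prod_between_le[OF k ky])+
  have \<rho>0: "\<rho> > 0" using \<rho>1(1) exp_gt_zero by (rule less_le_trans[rotated])
  have h0: "h > 0" using \<rho>0 by (simp add: h_def)
  have Rh: "?R + ?Rk = 2 * ?R * h"
    unfolding rprod_ratio[OF k ky] euler_R_conv_rprod[symmetric] \<rho>_def[symmetric] h_def by (simp add: algebra_simps)
  have s0: "s \<ge> 0" unfolding s_def by (rule sum_nonneg) simp
  \<comment> \<open>The arithmetic-geometric mean inequality for 1 and \<rho>; it loses no term in
    s^2.\<close>
  have "0 \<le> (1 - sqrt \<rho>) ^ 2" by simp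
  then have "sqrt \<rho> \<le> h" using \<rho>0 by (simp add: h_def power2_eq_square algebra_simps)
  then have "ln (sqrt \<rho>) \<le> ln h" using \<rho>0 h0 by (subst ln_le_cancel_iff) auto
  then have "ln \<rho> / 2 \<le> ln h" using \<rho>0 by (simp add: ln_sqrt)
  moreover have "- s - 6 * ln 4 / (real k * l) \<le> ln \<rho>" using \<rho>1(1) \<rho>0 by (subst ln_ge_iff) auto
  ultimately have "- s / 2 - 3 * ln 4 / (real k * l) \<le> ln h" by simp
  then have "2 * real k * (- s / 2 - 3 * ln 4 / (real k * l)) \<le> 2 * real k * ln h"
    by (intro mult_left_mono) auto
  then have hk: "- real k * s - 6 * ln 4 / l \<le> 2 * real k * ln h"
    using k l by (simp add: right_diff_distrib)
  have "(h * exp (- 2 * reson_const / l)) ^ (2 * k) * exp (- reson_const * (real k / l)) / 2 \<le> moment T y f k / (2 * ?R) ^ (2 * k)"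
    using moment_ge_fine M unfolding Rh l_def[symmetric]
    by (simp add: pos_le_divide_eq power_mult_distrib mult_ac)
  then have "ln ((h * exp (- 2 * reson_const / l)) ^ (2 * k) * exp (- reson_const * (real k / l)) / 2) \<le> L"
    unfolding L_def using h0 J M by (subst ln_le_cancel_iff) auto
  also have "ln ((h * exp (- 2 * reson_const / l)) ^ (2 * k) * exp (- reson_const * (real k / l)) / 2)
     = 2 * real k * (ln h - 2 * reson_const / l) - reson_const * (real k / l) - ln 2"
    using h0 by (simp add: ln_div ln_mult ln_realpow)
  \<comment> \<open>Four of the five come from the weight value raised to the power 2k, one from the
    norm of the weights.\<close>
  also have "\<dots> = 2 * real k * ln h - 5 * reson_const * real k / l - ln 2"
    by (simp add: algebra_simps)
  finally show "- real k * s - 6 * ln 4 / l - 5 * reson_const * real k / l - ln 2 \<le> L" using hk by linarith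
  have "h \<le> 1 + (- s / 2 + s\<^sup>2 / 4)" using \<rho>1(2) exp_minus_le_quadratic[OF s0] unfolding h_def by argo
  also have "\<dots> \<le> exp (- s / 2 + s\<^sup>2 / 4)" by (rule exp_ge_add_one_self)
  finally have "ln h \<le> ln (exp (- s / 2 + s\<^sup>2 / 4))" using h0 by (subst ln_le_cancel_iff) auto
  then have "2 * real k * ln h \<le> 2 * real k * (- s / 2 + s\<^sup>2 / 4)"
    unfolding ln_exp by (intro mult_left_mono) auto
  then have hk': "2 * real k * ln h \<le> - real k * s + real k * s\<^sup>2 / 2" by (simp add: algebra_simps)
  have "moment T y f k / (2 * ?R) ^ (2 * k) \<le> h ^ (2 * k) * (2 * exp (6 * ln 4 * (real k / l)))"
    using moment_le_fine M unfolding Rh l_def[symmetric]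
    by (simp add: pos_divide_le_eq power_mult_distrib mult_ac)
  then have "L \<le> ln (h ^ (2 * k) * (2 * exp (6 * ln 4 * (real k / l))))"
    unfolding L_def using h0 J M by (subst ln_le_cancel_iff) auto
  also have "\<dots> = 2 * real k * ln h + ln 2 + 6 * ln 4 * (real k / l)"
    using h0 by (simp add: ln_mult ln_realpow)
  finally show "L \<le> - real k * s + real k * s\<^sup>2 / 2 + 6 * ln 4 * real k / l + ln 2" using hk' by simp
qed

end

end

text \<open>Read l = ln k, u = ln \<alpha>, l + u = ln y, \<kappa> = k. Multiplying L by l/k turns
  it into -l s up to O(1 + l s^2), and the Mertens bounds place l s within O(1 + u^2/l) of
  u.\<close>

lemma error_term_bounds:
  fixes l u s K L \<kappa> a b :: real
  assumes l: "0 < l" "l \<le> \<kappa>" "ln 2 \<le> l" and u: "0 \<le> u" and K: "0 \<le> K" and s0: "0 \<le> s"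
    and ab: "0 \<le> a" "0 \<le> b" and \<kappa>: "\<kappa> \<ge> 1"
    and s1: "s \<le> (u + K) / l" and s2: "(u - K) / (l + u) \<le> s"
    and L1: "- \<kappa> * s - a / l - b * \<kappa> / l - ln 2 \<le> L"
    and L2: "L \<le> - \<kappa> * s + \<kappa> * s\<^sup>2 / 2 + a * \<kappa> / l + ln 2"
  shows "\<bar>l / \<kappa> * L + u\<bar> \<le> (3 + K + 2 * K\<^sup>2 + a + b) * (1 + u\<^sup>2 / l)"
proof -
  have ln2: "ln 2 \<le> (1::real)" "2 / 3 \<le> ln (2::real)"
    using ln_le_minus_one[of "2 :: real"] ln2_ge_two_thirds by auto
  have lk: "l / \<kappa> \<le> 1" "0 < l / \<kappa>" using l \<kappa> by auto
  have lk2: "l / \<kappa> * ln 2 \<le> 1" using mult_mono[of "l / \<kappa>" 1 "ln 2" 1] lk ln2 by simp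
  have u2: "0 \<le> u\<^sup>2 / l" using l by simp
  have c: "1 + u\<^sup>2 / l \<ge> 1" using u2 by simp
  have "- (K + a + b + 1) \<le> l / \<kappa> * L + u"
  proof -
    have "l / \<kappa> * (- \<kappa> * s - a / l - b * \<kappa> / l - ln 2) \<le> l / \<kappa> * L"
      using L1 lk by (intro mult_left_mono) auto
    also have "l / \<kappa> * (- \<kappa> * s - a / l - b * \<kappa> / l - ln 2) = - l * s - a / \<kappa> - b - l / \<kappa> * ln 2"
      using l \<kappa> by (simp add: field_simps)
    finally have 1: "- l * s - a / \<kappa> - b - l / \<kappa> * ln 2 \<le> l / \<kappa> * L" .
    have "l * s \<le> u + K" using s1 l by (simp add: field_simps)
    moreover have "a / \<kappa> \<le> a / 1" using ab \<kappa> by (intro divide_left_mono) auto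
    ultimately show ?thesis using 1 lk2 by simp
  qed
  moreover have "l / \<kappa> * L + u \<le> 2 * (u\<^sup>2 / l) + (K + 2 * K\<^sup>2 + a + 1)"
  proof -
    have "l / \<kappa> * L \<le> l / \<kappa> * (- \<kappa> * s + \<kappa> * s\<^sup>2 / 2 + a * \<kappa> / l + ln 2)"
      using L2 lk by (intro mult_left_mono) auto
    also have "\<dots> = - l * s + l * s\<^sup>2 / 2 + a + l / \<kappa> * ln 2"
      using l \<kappa> by (simp add: field_simps)
    finally have 1: "l / \<kappa> * L \<le> - l * s + l * s\<^sup>2 / 2 + a + 1" using lk2 by linarith
    have "l * ((u - K) / (l + u)) \<le> l * s" using s2 l by (intro mult_left_mono) auto
    \<comment> \<open>Replacing the denominator ln k by ln y in the lower bound for s is what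
      produces the error u^2/l.\<close>
    moreover have "u - l * ((u - K) / (l + u)) = (u\<^sup>2 + K * l) / (l + u)"
      using l u by (simp add: field_simps power2_eq_square)
    moreover have "(u\<^sup>2 + K * l) / (l + u) \<le> (u\<^sup>2 + K * l) / l"
      using l u K by (intro divide_left_mono) auto
    moreover have "(u\<^sup>2 + K * l) / l = u\<^sup>2 / l + K" using l by (simp add: field_simps)
    ultimately have 2: "u - l * s \<le> u\<^sup>2 / l + K" by linarith
    have "s\<^sup>2 \<le> ((u + K) / l)\<^sup>2" using s1 s0 by (intro power_mono) auto
    also have "\<dots> \<le> (2 * u\<^sup>2 + 2 * K\<^sup>2) / l\<^sup>2"
    proof -
      have "0 \<le> (u - K)\<^sup>2" by simp
      then have "(u + K)\<^sup>2 \<le> 2 * u\<^sup>2 + 2 * K\<^sup>2" by (simp add: power2_eq_square algebra_simps)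
      then show ?thesis by (simp add: power_divide divide_right_mono)
    qed
    finally have "l * s\<^sup>2 / 2 \<le> l * ((2 * u\<^sup>2 + 2 * K\<^sup>2) / l\<^sup>2) / 2"
      using l by (intro divide_right_mono mult_left_mono) auto
    also have "\<dots> = u\<^sup>2 / l + K\<^sup>2 / l" using l by (simp add: power2_eq_square field_simps)
    also have "K\<^sup>2 / l \<le> K\<^sup>2 / (1 / 2)" using l ln2 by (intro divide_left_mono) auto
    finally have 3: "l * s\<^sup>2 / 2 \<le> u\<^sup>2 / l + 2 * K\<^sup>2" by simp
    show ?thesis using 1 2 3 by linarith
  qed
  moreover have "K + a + b + 1 \<le> (3 + K + 2 * K\<^sup>2 + a + b) * 1" using ab K by simp
  moreover have "(3 + K + 2 * K\<^sup>2 + a + b) * 1 \<le> (3 + K + 2 * K\<^sup>2 + a + b) * (1 + u\<^sup>2 / l)"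
    using ab K c by (intro mult_left_mono) auto
  moreover have "2 * (u\<^sup>2 / l) + (K + 2 * K\<^sup>2 + a + 1) \<le> (3 + K + 2 * K\<^sup>2 + a + b) * (1 + u\<^sup>2 / l)"
  proof -
    have "2 * (u\<^sup>2 / l) \<le> (3 + K + 2 * K\<^sup>2 + a + b) * (u\<^sup>2 / l)"
      using ab K u2 by (intro mult_right_mono) auto
    moreover have "K + 2 * K\<^sup>2 + a + 1 \<le> 3 + K + 2 * K\<^sup>2 + a + b" using ab by simp
    ultimately show ?thesis by (simp only: distrib_left mult_1_right)
  qed
  ultimately show ?thesis by linarith
qed

section \<open>The moment formula in all ranges of y\<close>

lemma exponential_form:
  fixes J M l k a :: real
  assumes "J > 0" "M > 0" "l > 0" "k > 0"
  shows "J = M * exp (k / l * (- a + (l / k * ln (J / M) + a)))"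
proof -
  have "k / l * (- a + (l / k * ln (J / M) + a)) = ln (J / M)" using assms by simp
  then show ?thesis using assms by simp
qed

text \<open>For y < 2 the products are empty and the error term must equal ln \<alpha>. Since ln y
  may be close to 0, k can still be large, so the bound must use the term (ln \<alpha>)^2 / ln
  k.\<close>

lemma abs_ln_ratio_le_empty_product:
  fixes y :: real and k :: nat
  assumes y: "y < 2" and k: "k \<ge> 2" "real k \<le> y / (ln y)\<^sup>2"
  shows "\<bar>ln (y / real k)\<bar> \<le> 3 * (1 + (ln (y / real k))\<^sup>2 / ln (real k))"
proof -
  have y0: "y > 0"
  proof (rule ccontr)
    assume "\<not> y > 0"
    then have "y / (ln y)\<^sup>2 \<le> 0" by (intro divide_nonpos_nonneg) auto
    then show False using k by linarith
  qed
  have ln2: "ln (2::real) \<le> 1" "2 / 3 \<le> ln (2::real)"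
    using ln_le_minus_one[of "2 :: real"] ln2_ge_two_thirds by auto
  define l where "l = ln (real k)"
  have l: "l > 0" using k by (simp add: l_def)
  have "ln y < ln 2" using y y0 by (subst ln_less_cancel_iff) auto
  moreover have "ln y \<ge> - 1"
  proof (rule ccontr)
    assume "\<not> ln y \<ge> -1"
    then have "1 ^ 2 \<le> (- ln y)\<^sup>2" by (intro power_mono) auto
    then have "y / (ln y)\<^sup>2 \<le> y / 1" using y0 by (intro divide_left_mono) auto
    then show False using k y by simp
  qed
  ultimately have lny: "\<bar>ln y\<bar> \<le> 1" using ln2 by linarith
  define a where "a = ln (y / real k)"
  have a: "a = ln y - l" using y0 k by (simp add: a_def l_def ln_div)
  \<comment> \<open>As |ln y| \<le> 1, a is bounded when l \<le> 2; otherwise |a| \<ge> l - 1 \<ge>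
    l/2, so the quadratic term dominates.\<close>
  have "\<bar>a\<bar> \<le> 3 * (1 + a\<^sup>2 / l)"
  proof (cases "l \<le> 2")
    case True
    then have "\<bar>a\<bar> \<le> 3 * 1" using a lny l by linarith
    moreover have "0 \<le> a\<^sup>2 / l" using l by simp
    ultimately show ?thesis by simp
  next
    case False
    then have "\<bar>a\<bar> \<ge> l / 2" using a lny by linarith
    then have "l / 2 * \<bar>a\<bar> \<le> \<bar>a\<bar> * \<bar>a\<bar>" by (intro mult_right_mono) auto
    then have "\<bar>a\<bar> \<le> 2 * (a\<^sup>2 / l)" using l by (simp add: field_simps power2_eq_square)
    moreover have "0 \<le> a\<^sup>2 / l" using l by simp
    ultimately show ?thesis by simp
  qed
  then show ?thesis by (simp add: a_def l_def)
qed

text \<open>The quantifier order makes the implied constant and the threshold for T uniform in y, f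
  and k. The condition k \<ge> 2 keeps ln k positive, as the quotient k / ln k demands. The ranges y
  < 2, 2 \<le> y < e and y \<ge> e are treated separately.\<close>

theorem theorem5p2:
  "\<exists>C::real. \<forall>\<^sub>F T::real in at_top.
     \<forall>(y::real) (f::nat \<Rightarrow> complex) (k::nat) (\<alpha>::real).
       y \<le> ln T \<longrightarrow>
       completely_multiplicative f \<longrightarrow>
       (\<forall>n>0. cmod (f n) = 1) \<longrightarrow>
       k \<ge> 2 \<longrightarrow>
       real k \<le> y / (ln y)\<^sup>2 \<longrightarrow>
       \<alpha> = y / real k \<longrightarrow>
       (\<exists>E::real. \<bar>E\<bar> \<le> C * (1 + (ln \<alpha>)\<^sup>2 / ln (real k)) \<and>
          1 / T * integral {T..2 * T}
            (\<lambda>t. cmod (euler_L f (1 + \<i> * of_real t) y + of_real (euler_R y)) ^ (2 * k))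
          = (2 * euler_R y) ^ (2 * k) * exp (real k / ln (real k) * (- ln \<alpha> + E)))"
proof -
  obtain T0 :: real where T0: "T0 \<ge> 1"
    "\<And>T y k. \<lbrakk>T \<ge> T0; 2 \<le> y; y \<le> ln T; 2 \<le> k; real k \<le> y / (ln y)\<^sup>2\<rbrakk> \<Longrightarrow>
       (2 / T) powr (1 / (2 * ln y)) * (1 + qprod (1 / (2 * ln y)) (primes_le (nat \<lfloor>y\<rfloor>))) ^ (2 * k) \<le> 1 / 2"
    using off_diagonal_small by blast
  define K where "K = 2 * mertens_const"
  \<comment> \<open>40 covers the ranges with y < e; the other summands come from
    \<open>error_term_bounds\<close>.\<close>
  define C where "C = 40 + K + 2 * K\<^sup>2 + 6 * ln 4 + 5 * reson_const"
  have K: "K \<ge> 0" using mertens_const_pos by (simp add: K_def)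
  have C40: "C \<ge> 40"
  proof -
    have "0 \<le> 6 * ln (4::real)" "0 \<le> 2 * K\<^sup>2" "0 \<le> 5 * reson_const" using reson_const_pos by auto
    then show ?thesis using K unfolding C_def by linarith
  qed
  have "\<exists>E::real. \<bar>E\<bar> \<le> C * (1 + (ln \<alpha>)\<^sup>2 / ln (real k)) \<and>
          1 / T * integral {T..2 * T}
            (\<lambda>t. cmod (euler_L f (1 + \<i> * of_real t) y + of_real (euler_R y)) ^ (2 * k))
          = (2 * euler_R y) ^ (2 * k) * exp (real k / ln (real k) * (- ln \<alpha> + E))"
    if T: "T \<ge> T0" and yT: "y \<le> ln T" and f: "completely_multiplicative f" "\<forall>n>0. cmod (f n) = 1"
      and k: "k \<ge> 2" "real k \<le> y / (ln y)\<^sup>2" and \<alpha>: "\<alpha> = y / real k"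
    for T y \<alpha> :: real and f :: "nat \<Rightarrow> complex" and k :: nat
  proof (cases "y < 2")
    case True
    have "primes_le (nat \<lfloor>y\<rfloor>) = {}"
    proof -
      have "\<not> (prime p \<and> real p \<le> y)" for p using True prime_ge_2_nat[of p] by auto
      then show ?thesis unfolding primes_real_le_conv[symmetric] by blast
    qed
    then have "1 / T * integral {T..2 * T}
            (\<lambda>t. cmod (euler_L f (1 + \<i> * of_real t) y + of_real (euler_R y)) ^ (2 * k)) = (2 * euler_R y) ^ (2 * k)"
      using T T0(1) by (simp add: euler_L_conv_eprod euler_R_conv_rprod eprod_def rprod_def)
    moreover have "\<bar>ln \<alpha>\<bar> \<le> C * (1 + (ln \<alpha>)\<^sup>2 / ln (real k))"
    proof -
      have "\<bar>ln \<alpha>\<bar> \<le> 3 * (1 + (ln \<alpha>)\<^sup>2 / ln (real k))"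
        unfolding \<alpha> by (rule abs_ln_ratio_le_empty_product[OF True k])
      also have "\<dots> \<le> C * (1 + (ln \<alpha>)\<^sup>2 / ln (real k))"
        using C40 k by (intro mult_right_mono add_nonneg_nonneg) auto
      finally show ?thesis .
    qed
    \<comment> \<open>The moment equals (2R)^(2k) exactly, so the error term has to cancel -ln
      \<alpha>.\<close>
    ultimately show ?thesis by (intro exI[of _ "ln \<alpha>"]) simp
  next
    case False
    then have y: "y \<ge> 2" by simp
    have Tpos: "T > 0" using T T0(1) by linarith
    have f2: "\<And>n. n > 0 \<Longrightarrow> norm (f n) = 1" using f(2) by blast
    note small = T0(2)[OF T y yT k]
    define J where "J = moment T y f k"
    define M where "M = (2 * euler_R y) ^ (2 * k)"
    define l where "l = ln (real k)"
    define u where "u = ln y - l"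
    have u: "ln \<alpha> = u" using y k by (simp add: \<alpha> u_def l_def ln_div)
    have R: "euler_R y \<ge> 1" by (rule euler_R_ge_1)
    have M: "M > 0" using R by (simp add: M_def)
    have Jl: "euler_R y ^ (2 * k) / 2 \<le> J" and Ju: "J \<le> M"
      unfolding J_def M_def
      using moment_ge_crude[OF Tpos y k(1) f(1) f2 small] moment_le[OF Tpos y k(1) f(1) f2 small] by blast+
    have J: "J > 0" using Jl R by (smt (verit) half_gt_zero_iff zero_less_power)
    have l: "l > 0" "l \<le> real k" "ln 2 \<le> l"
      using k ln_le_minus_one[of "real k"] by (auto simp: l_def)
    have ln2: "ln (2::real) \<le> 1" "2 / 3 \<le> ln (2::real)"
      using ln_le_minus_one[of "2 :: real"] ln2_ge_two_thirds by auto
    define E where "E = l / real k * ln (J / M) + ln \<alpha>"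
    have "J = M * exp (real k / l * (- ln \<alpha> + E))"
      unfolding E_def using J M l k by (intro exponential_form) auto
    moreover have "\<bar>E\<bar> \<le> C * (1 + u\<^sup>2 / l)"
    proof (cases "y \<ge> exp 1")
      case True
      \<comment> \<open>ln y \<ge> 1 turns the hypothesis on k into k \<le> y, which the fine bounds
        require.\<close>
      then have lny: "ln y \<ge> 1" using y by (subst ln_ge_iff) auto
      then have "1 ^ 2 \<le> (ln y)\<^sup>2" by (intro power_mono) auto
      then have "y / (ln y)\<^sup>2 \<le> y / 1" using y by (intro divide_left_mono) auto
      then have ky: "real k \<le> y" using k by simp
      then have u0: "u \<ge> 0" using y k by (simp add: u_def l_def)
      define s where "s = (\<Sum>p\<in>primes_le (nat \<lfloor>y\<rfloor>) - primes_le k. 1 / real p)"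
      have "\<bar>l / real k * ln (J / M) + u\<bar> \<le> (3 + K + 2 * K\<^sup>2 + 6 * ln 4 + 5 * reson_const) * (1 + u\<^sup>2 / l)"
      proof (rule error_term_bounds)
        show "s \<le> (u + K) / l" "(u - K) / (l + u) \<le> s"
          using sum_inverse_between_le[OF k(1) ky] sum_inverse_between_ge[OF k(1) ky]
          by (simp_all add: s_def u_def l_def K_def)
        show "- real k * s - 6 * ln 4 / l - 5 * reson_const * real k / l - ln 2 \<le> ln (J / M)"
          "ln (J / M) \<le> - real k * s + real k * s\<^sup>2 / 2 + 6 * ln 4 * real k / l + ln 2"
          unfolding J_def M_def s_def l_def using log_moment_bounds[OF Tpos y k(1) f(1) f2 small ky] by simp_all
        show "0 \<le> s" unfolding s_def by (rule sum_nonneg) simp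
      qed (use l u0 K k reson_const_pos in auto)
      also have "\<dots> \<le> C * (1 + u\<^sup>2 / l)"
        using l by (intro mult_right_mono) (auto simp: C_def add_nonneg_nonneg)
      finally show ?thesis by (simp add: E_def u)
    next
      case False
      \<comment> \<open>Here 2 \<le> y < e, so k \<le> 6 and everything is bounded by absolute
        numbers.\<close>
      have y3: "y < 3" using False e_less_272 by linarith
      have "ln 2 \<le> ln y" using y by (subst ln_le_cancel_iff) auto
      moreover have "ln y \<le> y - 1" using y by (intro ln_le_minus_one) simp
      ultimately have lny: "2 / 3 \<le> ln y" "ln y \<le> 2" using ln2 y3 by linarith+
      have "(2 / 3) ^ 2 \<le> (ln y)\<^sup>2" using lny by (intro power_mono) auto
      then have "y / (ln y)\<^sup>2 \<le> y / (2 / 3) ^ 2" using y by (intro divide_left_mono) auto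
      moreover have "y / (2 / 3) ^ 2 < 27 / 4" using y3 by (simp add: power2_eq_square)
      ultimately have "real k < 27 / 4" using k(2) by linarith
      then have k6: "real k \<le> 6" by simp
      then have l5: "l \<le> 5" using ln_le_minus_one[of "real k"] k by (simp add: l_def)
      \<comment> \<open>The crude bounds alone give 4^(-k)/2 \<le> J/M \<le> 1.\<close>
      have "ln (1 / (2 * 4 ^ k)) \<le> ln (J / M)"
      proof (subst ln_le_cancel_iff)
        have "(2::real) ^ (2 * k) = 4 ^ k" by (simp add: power_mult)
        then have "M = 4 ^ k * euler_R y ^ (2 * k)" by (simp add: M_def power_mult_distrib)
        then show "1 / (2 * 4 ^ k) \<le> J / M" using Jl R M by (simp add: field_simps)
      qed (use J M in auto)
      also have "ln (1 / (2 * 4 ^ k)) = - ln 2 - real k * (2 * ln (2::real))"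
      proof -
        have "ln (4::real) = 2 * ln 2" using ln_realpow[of "2::real" 2] by simp
        then show ?thesis by (simp add: ln_div ln_mult ln_realpow)
      qed
      finally have "- (1 + real k * 2) \<le> ln (J / M)"
        using mult_left_mono[of "2 * ln 2" 2 "real k"] ln2 by simp
      then have "- 3 * real k \<le> ln (J / M)" using k by simp
      then have "l / real k * (- 3 * real k) \<le> l / real k * ln (J / M)"
        using l by (intro mult_left_mono) auto
      then have 1: "- 15 \<le> l / real k * ln (J / M)" using l5 k by simp
      have "ln (J / M) \<le> 0" using J M Ju by simp
      then have 2: "l / real k * ln (J / M) \<le> 0"
        using l by (intro mult_nonneg_nonpos) auto
      have "\<bar>u\<bar> \<le> 7" using lny l5 l by (simp add: u_def)
      then have "\<bar>E\<bar> \<le> 40 * 1" using 1 2 by (simp add: E_def u)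
      also have "\<dots> \<le> C * (1 + u\<^sup>2 / l)" using C40 l by (intro mult_mono) auto
      finally show ?thesis .
    qed
    ultimately show ?thesis
      unfolding u J_def M_def l_def moment_def by (intro exI[of _ E]) (simp add: u)
  qed
  then show ?thesis
    by (intro exI[of _ C] eventually_mono[OF eventually_ge_at_top[of T0]]) blast
qed

end
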